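(* Let $R$ be a ring. Then the following hold: (1) A division ring $R$ is $W\Delta U$ if and only if $R\cong\mathbb{Z}_2$ or $R\cong\mathbb{Z}_3$. (2) A local ring $R$ is $W\Delta U$ if and only if either $R/J(R)\cong\mathbb{Z}_2$ or $R/J(R)\cong\mathbb{Z}_3$. (3) A semi-simple ring $R$ is $W\Delta U$ if and only if $R\cong\bigoplus_{i=1}^n R_i$, where, for just only one index $i$, $R_i\cong\mathbb{Z}_3$, and $R_j\cong\mathbb{Z}_2$ for any other index $j\neq i$. (4) A semi-local ring $R$ is $W\Delta U$ if and only if $R/J(R)\cong\bigoplus_{i=1}^m R_i$, where, for just only one index $i$, $R_i\cong\mathbb{Z}_3$, and $R_j\cong\mathbb{Z}_2$ for any other index $j\neq i$.
   Context: Rings are associative with identity, not necessarily commutative. $J(R)$ is the Jacobson radical and $U(R)$ the group of units of $R$. $\Delta(R)=\{r\in R : r+u\in U(R)\text{ for all }u\in U(R)\}$; equivalently $\Delta(R)=J(T)$, where $T$ is the subring of $R$ generated by $U(R)$. $R$ is $W\Delta U$ if $U(R)=\pm 1+\Delta(R)$, i.e. every unit of $R$ has the form $1+d$ or $-1+d$ with $d\in\Delta(R)$. A ring $R$ is local if $R/J(R)$ is a division ring. Semi-simple means semi-simple Artinian; semi-local means that $R/J(R)$ is semi-simple Artinian. The direct sums are finite direct products of rings.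
   Formalization: In (3) and (4), "for just only one index i, R_i ≅ Z_3" is replaced by "for at most one index i" (all other factors Z_2), since with exactly one the claim is false: Z_2 is semi-simple and WΔU but has no factor Z_3. *)

theory Defs
  imports "HOL-Algebra.Algebra" "HOL-Number_Theory.Residues"
begin

text \<open>
  Rings are those of the locale \<^locale>\<open>ring\<close>: associative, unital, not necessarily commutative; the
  zero ring is allowed.
\<close>

definition left_ideal :: "'a set \<Rightarrow> ('a, 'm) ring_scheme \<Rightarrow> bool" where
  "left_ideal I R \<longleftrightarrow>
     additive_subgroup I R \<and> (\<forall>x \<in> carrier R. \<forall>a \<in> I. x \<otimes>\<^bsub>R\<^esub> a \<in> I)"

definition right_ideal :: "'a set \<Rightarrow> ('a, 'm) ring_scheme \<Rightarrow> bool" where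
  "right_ideal I R \<longleftrightarrow>
     additive_subgroup I R \<and> (\<forall>x \<in> carrier R. \<forall>a \<in> I. a \<otimes>\<^bsub>R\<^esub> x \<in> I)"

definition maximal_left_ideal :: "'a set \<Rightarrow> ('a, 'm) ring_scheme \<Rightarrow> bool" where
  "maximal_left_ideal M R \<longleftrightarrow>
     left_ideal M R \<and> M \<noteq> carrier R \<and>
     (\<forall>I. left_ideal I R \<and> M \<subseteq> I \<longrightarrow> I = M \<or> I = carrier R)"

text \<open>Intersecting with the carrier only matters for the zero ring, which has no maximal left ideal.\<close>

definition jacobson_radical :: "('a, 'm) ring_scheme \<Rightarrow> 'a set" where
  "jacobson_radical R = carrier R \<inter> \<Inter> {M. maximal_left_ideal M R}"

definition Delta :: "('a, 'm) ring_scheme \<Rightarrow> 'a set" where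
  "Delta R = {r \<in> carrier R. \<forall>u \<in> Units R. r \<oplus>\<^bsub>R\<^esub> u \<in> Units R}"

definition WDeltaU :: "('a, 'm) ring_scheme \<Rightarrow> bool" where
  "WDeltaU R \<longleftrightarrow>
     Units R = {\<one>\<^bsub>R\<^esub> \<oplus>\<^bsub>R\<^esub> d | d. d \<in> Delta R} \<union> {(\<ominus>\<^bsub>R\<^esub> \<one>\<^bsub>R\<^esub>) \<oplus>\<^bsub>R\<^esub> d | d. d \<in> Delta R}"

definition is_division_ring :: "('a, 'm) ring_scheme \<Rightarrow> bool" where
  "is_division_ring R \<longleftrightarrow>
     ring R \<and> \<one>\<^bsub>R\<^esub> \<noteq> \<zero>\<^bsub>R\<^esub> \<and> Units R = carrier R - {\<zero>\<^bsub>R\<^esub>}"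

definition is_local_ring :: "('a, 'm) ring_scheme \<Rightarrow> bool" where
  "is_local_ring R \<longleftrightarrow> ring R \<and> is_division_ring (R Quot jacobson_radical R)"

definition left_artinian :: "('a, 'm) ring_scheme \<Rightarrow> bool" where
  "left_artinian R \<longleftrightarrow>
     (\<forall>I :: nat \<Rightarrow> 'a set. (\<forall>n. left_ideal (I n) R) \<and> (\<forall>n. I (Suc n) \<subseteq> I n) \<longrightarrow>
        (\<exists>N. \<forall>n \<ge> N. I n = I N))"

definition right_artinian :: "('a, 'm) ring_scheme \<Rightarrow> bool" where
  "right_artinian R \<longleftrightarrow>
     (\<forall>I :: nat \<Rightarrow> 'a set. (\<forall>n. right_ideal (I n) R) \<and> (\<forall>n. I (Suc n) \<subseteq> I n) \<longrightarrow>
        (\<exists>N. \<forall>n \<ge> N. I n = I N))"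

text \<open>Semi-simple Artinian in the classical sense: Artinian (on both sides) with zero radical.\<close>

definition semisimple_artinian :: "('a, 'm) ring_scheme \<Rightarrow> bool" where
  "semisimple_artinian R \<longleftrightarrow>
     ring R \<and> jacobson_radical R = {\<zero>\<^bsub>R\<^esub>} \<and> left_artinian R \<and> right_artinian R"

definition is_semilocal_ring :: "('a, 'm) ring_scheme \<Rightarrow> bool" where
  "is_semilocal_ring R \<longleftrightarrow> ring R \<and> semisimple_artinian (R Quot jacobson_radical R)"

text \<open>
  A finite direct sum of copies of \<open>\<int>\<^sub>2\<close> and \<open>\<int>\<^sub>3\<close> in which at most one summand is \<open>\<int>\<^sub>3\<close>. Reading ``just
  only one index'' as ``exactly one'' would make the characterisation of semi-simple rings false:
  \<open>\<int>\<^sub>2\<close> itself has unit group \<open>{1}\<close>, hence satisfies \<^const>\<open>WDeltaU\<close>, but has no summand \<open>\<int>\<^sub>3\<close>.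
  Summands isomorphic to \<open>\<int>\<^sub>2\<close> or \<open>\<int>\<^sub>3\<close> can be realised on the type \<^typ>\<open>int\<close>, so quantifying over
  \<^typ>\<open>int\<close> rings loses nothing. The empty sum is the zero ring.
\<close>

definition sum_of_Z2_at_most_one_Z3 :: "('a, 'm) ring_scheme \<Rightarrow> bool" where
  "sum_of_Z2_at_most_one_Z3 R \<longleftrightarrow>
     (\<exists>Rs :: int ring list.
        (\<forall>i < length Rs. ring (Rs ! i)) \<and>
        R \<simeq> RDirProd_list Rs \<and>
        (\<forall>i < length Rs. Rs ! i \<simeq> residue_ring 2 \<or> Rs ! i \<simeq> residue_ring 3) \<and>
        (\<forall>i < length Rs. \<forall>j < length Rs.
            Rs ! i \<simeq> residue_ring 3 \<and> Rs ! j \<simeq> residue_ring 3 \<longrightarrow> i = j))"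

end

theory Submission
  imports Defs
begin

text \<open>
  Units lift modulo \<open>J(R)\<close>, so \<open>R\<close> is \<open>W\<Delta>U\<close> iff \<open>R/J(R)\<close> is. The heart of the matter is a semi-simple
  \<open>W\<Delta>U\<close> ring \<open>R\<close>, treated without the Wedderburn--Artin theorem. For an idempotent \<open>e\<close>, the elements of
  \<open>eR(1 - e)\<close> and \<open>(1 - e)Re\<close> lie in \<open>\<Delta>(R)\<close>, which is closed under products; this forces
  \<open>eR(1 - e) \<subseteq> J(R) = 0\<close>, so idempotents are central. The chain conditions then write every element as a
  unit times an idempotent. Hence \<open>\<Delta>(R) = 0\<close>, the units are \<open>\<plusminus>1\<close>, and every element is \<open>\<plusminus>e\<close> with \<open>e\<close>
  idempotent. Splitting off minimal idempotents \<open>f\<close> decomposes \<open>R\<close> into factors \<open>fR = {0, f, -f}\<close>; two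
  factors \<open>\<int>\<^sub>3\<close> would give units other than \<open>\<plusminus>1\<close>.
\<close>

section \<open>The Jacobson radical\<close>

text \<open>The obstacle is that \<open>Delta R\<close> absorbs units on both sides, but in general
  not arbitrary ring elements. Membership of a corner element in \<open>Delta R\<close> is therefore
  weaker than membership in the radical, which is tested against every \<open>y\<close>. The gap
  closes because only the opposite corner
  \<open>(\<one> \<ominus> e) \<otimes> y \<otimes> e\<close> of \<open>y\<close> matters in that
  test, and it lies in \<open>Delta R\<close> for the same reason. The unit-times-idempotent form is
  a Fitting argument: a power of \<open>x\<close> singles out an idempotent \<open>e\<close> that is
  a multiple of \<open>x\<close> from the left and from the right, and \<open>x\<close> is nilpotent
  on the complement. The left multiple comes from the chain of left ideals, the right multiple from
  that of right ideals. Nilpotent elements then vanish, because central idempotents push them into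
  the radical.\<close>

context ring begin

text \<open>The rules of the method \<open>algebra\<close> for non-commutative rings lack the right unit law.\<close>

lemmas ring_r_one [algebra ring "\<zero>" "(\<oplus>)" "a_inv R" "a_minus R" "\<one>" "(\<otimes>)"] = r_one

lemma left_ideal_mult_closed:
  assumes "left_ideal I R" "x \<in> carrier R" "a \<in> I"
  shows "x \<otimes> a \<in> I"
  using assms by (auto simp: left_ideal_def)

lemma left_idealI:
  assumes "I \<subseteq> carrier R" "\<zero> \<in> I" "\<And>a b. a \<in> I \<Longrightarrow> b \<in> I \<Longrightarrow> a \<oplus> b \<in> I"
    and "\<And>x a. x \<in> carrier R \<Longrightarrow> a \<in> I \<Longrightarrow> x \<otimes> a \<in> I"
  shows "left_ideal I R"
proof -
  have "\<ominus> a \<in> I" if "a \<in> I" for a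
    using assms(4)[of "\<ominus> \<one>" a] that assms(1) by (auto simp: l_minus)
  then have "subgroup I (add_monoid R)"
    using assms by (intro add.subgroupI) (auto simp: a_inv_def)
  then show ?thesis
    using assms(4) by (auto simp: left_ideal_def additive_subgroup_def)
qed

lemma right_idealI:
  assumes "I \<subseteq> carrier R" "\<zero> \<in> I" "\<And>a b. a \<in> I \<Longrightarrow> b \<in> I \<Longrightarrow> a \<oplus> b \<in> I"
    and "\<And>x a. x \<in> carrier R \<Longrightarrow> a \<in> I \<Longrightarrow> a \<otimes> x \<in> I"
  shows "right_ideal I R"
proof -
  have "\<ominus> a \<in> I" if "a \<in> I" for a
    using assms(4)[of "\<ominus> \<one>" a] that assms(1) by (auto simp: r_minus)
  then have "subgroup I (add_monoid R)"
    using assms by (intro add.subgroupI) (auto simp: a_inv_def)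
  then show ?thesis
    using assms(4) by (auto simp: right_ideal_def additive_subgroup_def)
qed

lemma left_ideal_subset: "left_ideal I R \<Longrightarrow> I \<subseteq> carrier R"
  and left_ideal_zero: "left_ideal I R \<Longrightarrow> \<zero> \<in> I"
  and left_ideal_add: "left_ideal I R \<Longrightarrow> a \<in> I \<Longrightarrow> b \<in> I \<Longrightarrow> a \<oplus> b \<in> I"
  by (auto simp: left_ideal_def additive_subgroup.zero_closed additive_subgroup.a_closed
           dest: additive_subgroup.a_subset)

lemma left_ideal_principal:
  assumes "x \<in> carrier R"
  shows "left_ideal {r \<otimes> x | r. r \<in> carrier R} R"
proof (rule left_idealI)
  show "\<zero> \<in> {r \<otimes> x | r. r \<in> carrier R}" using assms by (auto intro!: exI[of _ \<zero>])
  fix a b assume "a \<in> {r \<otimes> x | r. r \<in> carrier R}" "b \<in> {r \<otimes> x | r. r \<in> carrier R}"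
  then show "a \<oplus> b \<in> {r \<otimes> x | r. r \<in> carrier R}"
    using assms by (auto simp flip: l_distr)
next
  fix y a assume "y \<in> carrier R" "a \<in> {r \<otimes> x | r. r \<in> carrier R}"
  then show "y \<otimes> a \<in> {r \<otimes> x | r. r \<in> carrier R}"
    using assms by (auto simp flip: m_assoc)
qed (use assms in auto)

lemma right_ideal_principal:
  assumes "x \<in> carrier R"
  shows "right_ideal {x \<otimes> r | r. r \<in> carrier R} R"
proof (rule right_idealI)
  show "\<zero> \<in> {x \<otimes> r | r. r \<in> carrier R}" using assms by (auto intro!: exI[of _ \<zero>])
  fix a b assume "a \<in> {x \<otimes> r | r. r \<in> carrier R}" "b \<in> {x \<otimes> r | r. r \<in> carrier R}"
  then show "a \<oplus> b \<in> {x \<otimes> r | r. r \<in> carrier R}"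
    using assms by (auto simp flip: r_distr)
next
  fix y a assume "y \<in> carrier R" "a \<in> {x \<otimes> r | r. r \<in> carrier R}"
  then show "a \<otimes> y \<in> {x \<otimes> r | r. r \<in> carrier R}"
    using assms by (auto simp: m_assoc)
qed (use assms in auto)

lemma left_ideal_one:
  assumes "left_ideal I R" "\<one> \<in> I"
  shows "I = carrier R"
  using left_ideal_mult_closed[OF assms(1) _ assms(2)] left_ideal_subset[OF assms(1)] by auto

lemma left_ideal_Union_chain:
  assumes ne: "C \<noteq> {}" and chain: "\<And>I K. I \<in> C \<Longrightarrow> K \<in> C \<Longrightarrow> I \<subseteq> K \<or> K \<subseteq> I"
    and li: "\<And>I. I \<in> C \<Longrightarrow> left_ideal I R"
  shows "left_ideal (\<Union>C) R"
proof (rule left_idealI)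
  show "\<Union>C \<subseteq> carrier R" using left_ideal_subset[OF li] by blast
  show "\<zero> \<in> \<Union>C" using left_ideal_zero[OF li] ne by blast
  fix a b assume "a \<in> \<Union>C" "b \<in> \<Union>C"
  then obtain I K where IK: "I \<in> C" "K \<in> C" "a \<in> I" "b \<in> K" by blast
  then show "a \<oplus> b \<in> \<Union>C"
    using chain[OF IK(1,2)] left_ideal_add[OF li[OF IK(1)]] left_ideal_add[OF li[OF IK(2)]] by blast
qed (use left_ideal_mult_closed[OF li] in blast)

text \<open>Zorn's lemma applies because properness, phrased as \<open>\<one> \<notin> K\<close>,
  survives unions of chains. A larger left ideal outside \<open>?A\<close> contains
  \<open>\<one>\<close> and is the whole carrier.\<close>

lemma proper_left_ideal_in_maximal:
  assumes "left_ideal I R" "\<one> \<notin> I"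
  obtains M where "maximal_left_ideal M R" "I \<subseteq> M"
proof -
  let ?A = "{K. left_ideal K R \<and> I \<subseteq> K \<and> \<one> \<notin> K}"
  have "\<Union>C \<in> ?A" if "C \<noteq> {}" "subset.chain ?A C" for C
  proof -
    have "left_ideal (\<Union>C) R"
      by (rule left_ideal_Union_chain[OF that(1)]) (use that(2) in \<open>auto simp: subset.chain_def\<close>)
    then show ?thesis using that by (auto simp: subset.chain_def)
  qed
  moreover have "?A \<noteq> {}" using assms by auto
  ultimately obtain M where M: "M \<in> ?A" "\<forall>K \<in> ?A. M \<subseteq> K \<longrightarrow> K = M"
    using subset_Zorn_nonempty[of ?A] by blast
  have "maximal_left_ideal M R"
    unfolding maximal_left_ideal_def
  proof (intro conjI allI impI)
    fix K assume K: "left_ideal K R \<and> M \<subseteq> K"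
    show "K = M \<or> K = carrier R"
      using left_ideal_one[of K] M K by blast
  qed (use M in auto)
  then show thesis using M that by blast
qed

text \<open>Otherwise the left ideal generated by \<open>\<one> \<ominus> y \<otimes> x\<close> is
  proper and lies in a maximal one, which also contains \<open>y \<otimes> x\<close> and hence
  \<open>\<one>\<close>.\<close>

lemma jacobson_radical_left_inv:
  assumes "x \<in> jacobson_radical R" "y \<in> carrier R"
  shows "\<exists>s \<in> carrier R. s \<otimes> (\<one> \<ominus> y \<otimes> x) = \<one>"
proof (rule ccontr)
  have x: "x \<in> carrier R" using assms by (simp add: jacobson_radical_def)
  let ?L = "{r \<otimes> (\<one> \<ominus> y \<otimes> x) | r. r \<in> carrier R}"
  assume "\<not> ?thesis"
  then have "\<one> \<notin> ?L" by force
  moreover have "left_ideal ?L R" using x assms(2) by (intro left_ideal_principal) auto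
  ultimately obtain M where M: "maximal_left_ideal M R" "?L \<subseteq> M"
    using proper_left_ideal_in_maximal by blast
  then have li: "left_ideal M R" by (simp add: maximal_left_ideal_def)
  have "\<one> \<ominus> y \<otimes> x \<in> ?L" using x assms(2) by (auto intro!: exI[of _ \<one>])
  then have "\<one> \<ominus> y \<otimes> x \<in> M" using M(2) by blast
  moreover have "y \<otimes> x \<in> M"
    using left_ideal_mult_closed[OF li assms(2)] assms(1) M(1) by (auto simp: jacobson_radical_def)
  ultimately have "(\<one> \<ominus> y \<otimes> x) \<oplus> y \<otimes> x \<in> M" by (rule left_ideal_add[OF li])
  moreover have "(\<one> \<ominus> y \<otimes> x) \<oplus> y \<otimes> x = \<one>" using x assms(2) by algebra
  ultimately show False using left_ideal_one[OF li] M(1) by (simp add: maximal_left_ideal_def)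
qed

text \<open>If a maximal left ideal \<open>M\<close> misses \<open>x\<close>, then \<open>M\<close>
  and \<open>x\<close> generate everything, so \<open>\<one> = m \<oplus> y \<otimes> x\<close> with
  \<open>m \<in> M\<close>. But then \<open>m = \<one> \<ominus> y \<otimes> x\<close> has a left
  inverse, and \<open>M\<close> is not proper.\<close>

lemma jacobson_radicalI:
  assumes x: "x \<in> carrier R"
    and inv: "\<And>y. y \<in> carrier R \<Longrightarrow> \<exists>s \<in> carrier R. s \<otimes> (\<one> \<ominus> y \<otimes> x) = \<one>"
  shows "x \<in> jacobson_radical R"
  unfolding jacobson_radical_def
proof (intro IntI InterI x, clarify, rule ccontr)
  fix M assume M: "maximal_left_ideal M R" and xM: "x \<notin> M"
  then have li: "left_ideal M R" by (simp add: maximal_left_ideal_def)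
  note MR = left_ideal_subset[OF li, THEN subsetD]
  let ?K = "{m \<oplus> y \<otimes> x | m y. m \<in> M \<and> y \<in> carrier R}"
  have K: "left_ideal ?K R"
  proof (rule left_idealI)
    show "\<zero> \<in> ?K" using x left_ideal_zero[OF li] by (force intro!: exI[of _ \<zero>])
    show "?K \<subseteq> carrier R" using MR x by auto
    fix a b assume "a \<in> ?K" "b \<in> ?K"
    then obtain m y m' y' where *: "m \<in> M" "m' \<in> M" "y \<in> carrier R" "y' \<in> carrier R"
      "a = m \<oplus> y \<otimes> x" "b = m' \<oplus> y' \<otimes> x" by blast
    have "a \<oplus> b = (m \<oplus> m') \<oplus> (y \<oplus> y') \<otimes> x"
      unfolding *(5,6) using *(1-4) MR[OF *(1)] MR[OF *(2)] x by algebra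
    then show "a \<oplus> b \<in> ?K" using * left_ideal_add[OF li] by blast
  next
    fix z a assume z: "z \<in> carrier R" and "a \<in> ?K"
    then obtain m y where *: "m \<in> M" "y \<in> carrier R" "a = m \<oplus> y \<otimes> x" by blast
    have "z \<otimes> a = z \<otimes> m \<oplus> (z \<otimes> y) \<otimes> x"
      unfolding *(3) using *(1,2) MR[OF *(1)] x z by algebra
    then show "z \<otimes> a \<in> ?K" using * z left_ideal_mult_closed[OF li z] by blast
  qed
  have "M \<subseteq> ?K"
  proof
    fix m assume "m \<in> M"
    then have "m = m \<oplus> \<zero> \<otimes> x" "m \<in> M" using MR x by auto
    then show "m \<in> ?K" using zero_closed by blast
  qed
  moreover have "x \<in> ?K"
  proof -
    have "x = \<zero> \<oplus> \<one> \<otimes> x" using x by simp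
    then show ?thesis using left_ideal_zero[OF li] one_closed by blast
  qed
  ultimately have "?K = carrier R"
    using M K xM unfolding maximal_left_ideal_def by blast
  then obtain m y where my: "m \<in> M" "y \<in> carrier R" "\<one> = m \<oplus> y \<otimes> x"
    using one_closed by blast
  have "m = \<one> \<ominus> y \<otimes> x" unfolding my(3) using my(1,2) MR[OF my(1)] x by algebra
  then obtain s where "s \<in> carrier R" "s \<otimes> m = \<one>" using inv[OF my(2)] by blast
  then have "\<one> \<in> M" using left_ideal_mult_closed[OF li _ my(1)] by force
  then show False using left_ideal_one[OF li] M by (simp add: maximal_left_ideal_def)
qed

text \<open>The witness \<open>\<one> \<oplus> y \<otimes> s \<otimes> x\<close> is suggested by the
  formal geometric series: the sum of all \<open>(y x)^n\<close> is \<open>1\<close> plus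
  \<open>y\<close> times the sum of all \<open>(x y)^n\<close> times \<open>x\<close>.\<close>

lemma left_inv_one_minus_swap:
  assumes "x \<in> carrier R" "y \<in> carrier R" "s \<in> carrier R" "s \<otimes> (\<one> \<ominus> x \<otimes> y) = \<one>"
  shows "\<exists>t \<in> carrier R. t \<otimes> (\<one> \<ominus> y \<otimes> x) = \<one>"
proof
  show "(\<one> \<oplus> y \<otimes> s \<otimes> x) \<in> carrier R" using assms by auto
  have "(\<one> \<oplus> y \<otimes> s \<otimes> x) \<otimes> (\<one> \<ominus> y \<otimes> x) = \<one> \<ominus> y \<otimes> x \<oplus> y \<otimes> (s \<otimes> (\<one> \<ominus> x \<otimes> y)) \<otimes> x"
    using assms(1-3) by algebra
  also have "\<dots> = \<one>" unfolding assms(4) using assms(1,2) by algebra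
  finally show "(\<one> \<oplus> y \<otimes> s \<otimes> x) \<otimes> (\<one> \<ominus> y \<otimes> x) = \<one>" .
qed

lemma jacobson_radical_carrier: "x \<in> jacobson_radical R \<Longrightarrow> x \<in> carrier R"
  by (simp add: jacobson_radical_def)

lemma left_ideal_jacobson_radical: "left_ideal (jacobson_radical R) R"
proof (rule left_idealI)
  show "jacobson_radical R \<subseteq> carrier R" by (auto simp: jacobson_radical_def)
qed (auto simp: jacobson_radical_def maximal_left_ideal_def
      intro: left_ideal_zero left_ideal_add left_ideal_mult_closed)

text \<open>Maximal left ideals give closure on the left only. The swap lemma turns a left inverse
  of \<open>\<one> \<ominus> z \<otimes> (y \<otimes> x)\<close> into one of
  \<open>\<one> \<ominus> (y \<otimes> x) \<otimes> z\<close>.\<close>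

lemma jacobson_radical_mult_right:
  assumes "x \<in> jacobson_radical R" "z \<in> carrier R"
  shows "x \<otimes> z \<in> jacobson_radical R"
proof (rule jacobson_radicalI)
  have x: "x \<in> carrier R" using assms(1) by (rule jacobson_radical_carrier)
  then show "x \<otimes> z \<in> carrier R" using assms(2) by simp
  fix y assume y: "y \<in> carrier R"
  obtain s where "s \<in> carrier R" "s \<otimes> (\<one> \<ominus> (z \<otimes> y) \<otimes> x) = \<one>"
    using jacobson_radical_left_inv[OF assms(1)] assms(2) y by blast
  then show "\<exists>s\<in>carrier R. s \<otimes> (\<one> \<ominus> y \<otimes> (x \<otimes> z)) = \<one>"
    using left_inv_one_minus_swap[of z "y \<otimes> x" s] x y assms(2) by (simp add: m_assoc)
qed

lemma ideal_jacobson_radical: "ideal (jacobson_radical R) R"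
proof (rule idealI)
  show "subgroup (jacobson_radical R) (add_monoid R)"
    using left_ideal_jacobson_radical by (simp add: left_ideal_def additive_subgroup_def)
qed (use left_ideal_jacobson_radical jacobson_radical_mult_right ring_axioms
      in \<open>auto simp: left_ideal_def\<close>)

lemma Units_left_right:
  assumes "x \<in> carrier R" "l \<in> carrier R" "r \<in> carrier R" "l \<otimes> x = \<one>" "x \<otimes> r = \<one>"
  shows "x \<in> Units R"
  using inv_unique[OF assms(4,5)] assms by (auto simp: Units_def)

lemma Units_uminus: "u \<in> Units R \<Longrightarrow> \<ominus> u \<in> Units R"
  using Units_left_right[of "\<ominus> u" "\<ominus> (inv u)" "\<ominus> (inv u)"]
  by (simp add: Units_closed l_minus r_minus)

lemma one_minus_jacobson_radical_Units:
  assumes "x \<in> jacobson_radical R"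
  shows "\<one> \<ominus> x \<in> Units R"
proof -
  have x: "x \<in> carrier R" using assms by (rule jacobson_radical_carrier)
  obtain s where s: "s \<in> carrier R" "s \<otimes> (\<one> \<ominus> x) = \<one>"
    using jacobson_radical_left_inv[OF assms one_closed] x by auto
  \<comment> \<open>The left inverse \<open>s\<close> again has the form
    \<open>\<one> \<ominus> (\<ominus> s) \<otimes> x\<close>, so it has a left inverse too. As
    \<open>\<one> \<ominus> x\<close> is its right inverse, \<open>s\<close> is a unit.\<close>
  have "s = s \<otimes> (\<one> \<ominus> x) \<oplus> s \<otimes> x" using s(1) x by algebra
  then have seq: "s = \<one> \<ominus> (\<ominus> s) \<otimes> x" using s x by (simp add: minus_eq l_minus)
  obtain t where t: "t \<in> carrier R" "t \<otimes> s = \<one>"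
    using jacobson_radical_left_inv[OF assms, of "\<ominus> s"] s(1) seq by auto
  have "s \<in> Units R" using Units_left_right[of s t "\<one> \<ominus> x"] s t x by auto
  then show ?thesis using Units_left_right[of "\<one> \<ominus> x" s s] s x t inv_unique[of t s "\<one> \<ominus> x"] by auto
qed

lemma Units_add_jacobson_radical:
  assumes "u \<in> Units R" "x \<in> jacobson_radical R"
  shows "u \<oplus> x \<in> Units R"
proof -
  have x: "x \<in> carrier R" and u: "u \<in> carrier R" and i: "inv u \<in> carrier R"
    using assms by (auto dest: jacobson_radical_carrier)
  have "(\<ominus> (inv u)) \<otimes> x \<in> jacobson_radical R"
    by (rule left_ideal_mult_closed[OF left_ideal_jacobson_radical]) (use assms in auto)
  then have "u \<otimes> (\<one> \<ominus> (\<ominus> (inv u)) \<otimes> x) \<in> Units R"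
    using one_minus_jacobson_radical_Units assms(1) by blast
  moreover have "u \<otimes> (\<one> \<ominus> (\<ominus> (inv u)) \<otimes> x) = u \<oplus> (u \<otimes> inv u) \<otimes> x"
    using x u i by (simp add: ring_simprules del: Units_r_inv)
  ultimately show ?thesis using assms(1) x by simp
qed

end

section \<open>The set \<open>\<Delta>(R)\<close>\<close>

context ring begin

lemma DeltaD: "d \<in> Delta R \<Longrightarrow> u \<in> Units R \<Longrightarrow> d \<oplus> u \<in> Units R"
  and Delta_carrier: "d \<in> Delta R \<Longrightarrow> d \<in> carrier R"
  by (auto simp: Delta_def)

lemma Delta_add: "c \<in> Delta R \<Longrightarrow> d \<in> Delta R \<Longrightarrow> c \<oplus> d \<in> Delta R"
  by (auto simp: Delta_def a_assoc Units_closed)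

lemma Delta_mult_Units_left:
  assumes "d \<in> Delta R" "u \<in> Units R"
  shows "u \<otimes> d \<in> Delta R"
proof -
  have c: "d \<in> carrier R" "u \<in> carrier R" using assms by (auto dest: Delta_carrier)
  have "u \<otimes> d \<oplus> v \<in> Units R" if v: "v \<in> Units R" for v
  proof -
    have "u \<otimes> d \<oplus> v = u \<otimes> (d \<oplus> inv u \<otimes> v)"
      using c assms(2) v by (simp add: r_distr Units_closed flip: m_assoc)
    then show ?thesis using DeltaD[OF assms(1), of "inv u \<otimes> v"] assms(2) v by simp
  qed
  then show ?thesis using c by (auto simp: Delta_def)
qed

lemma Delta_mult_Units_right:
  assumes "d \<in> Delta R" "u \<in> Units R"
  shows "d \<otimes> u \<in> Delta R"
proof -
  have c: "d \<in> carrier R" "u \<in> carrier R" using assms by (auto dest: Delta_carrier)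
  have "d \<otimes> u \<oplus> v \<in> Units R" if v: "v \<in> Units R" for v
  proof -
    have "d \<otimes> u \<oplus> v = (d \<oplus> v \<otimes> inv u) \<otimes> u"
      using c assms(2) v by (simp add: l_distr m_assoc Units_closed)
    then show ?thesis using DeltaD[OF assms(1), of "v \<otimes> inv u"] assms(2) v by simp
  qed
  then show ?thesis using c by (auto simp: Delta_def)
qed

lemma Delta_uminus: "d \<in> Delta R \<Longrightarrow> \<ominus> d \<in> Delta R"
  using Delta_mult_Units_left[of d "\<ominus> \<one>"] Units_uminus[OF Units_one_closed] Delta_carrier[of d]
  by (simp add: l_minus)

lemma Delta_minus: "c \<in> Delta R \<Longrightarrow> d \<in> Delta R \<Longrightarrow> c \<ominus> d \<in> Delta R"
  using Delta_add Delta_uminus by (simp add: minus_eq)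

text \<open>Since \<open>d \<oplus> \<one>\<close> is a unit, writing \<open>c \<otimes> d\<close>
  as \<open>c \<otimes> (d \<oplus> \<one>) \<ominus> c\<close> reduces products to absorption of
  units and differences.\<close>

lemma Delta_mult:
  assumes "c \<in> Delta R" "d \<in> Delta R"
  shows "c \<otimes> d \<in> Delta R"
proof -
  have C: "c \<in> carrier R" "d \<in> carrier R" using assms by (auto dest: Delta_carrier)
  have "c \<otimes> (d \<oplus> \<one>) \<ominus> c \<in> Delta R"
    using assms by (intro Delta_minus Delta_mult_Units_right DeltaD) auto
  moreover have "c \<otimes> (d \<oplus> \<one>) \<ominus> c = c \<otimes> d" using C by algebra+
  ultimately show ?thesis by simp
qed

section \<open>Elementwise form of \<open>WDeltaU\<close> and passage to the quotient by the
  radical\<close>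

lemma WDeltaU_iff:
  "WDeltaU R \<longleftrightarrow> (\<forall>u \<in> Units R. u \<ominus> \<one> \<in> Delta R \<or> u \<oplus> \<one> \<in> Delta R)"
proof -
  have 1: "(\<exists>d. u = \<one> \<oplus> d \<and> d \<in> Delta R) \<longleftrightarrow> u \<ominus> \<one> \<in> Delta R"
   and 2: "(\<exists>d. u = \<ominus> \<one> \<oplus> d \<and> d \<in> Delta R) \<longleftrightarrow> u \<oplus> \<one> \<in> Delta R" if u: "u \<in> Units R" for u
  proof -
    have "u = \<one> \<oplus> (u \<ominus> \<one>)" "u = \<ominus> \<one> \<oplus> (u \<oplus> \<one>)" using Units_closed[OF u] by algebra+
    moreover have "\<one> \<oplus> d \<ominus> \<one> = d" "\<ominus> \<one> \<oplus> d \<oplus> \<one> = d" if "d \<in> Delta R" for d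
      using Delta_carrier[OF that] by algebra+
    ultimately show
      "(\<exists>d. u = \<one> \<oplus> d \<and> d \<in> Delta R) \<longleftrightarrow> u \<ominus> \<one> \<in> Delta R"
      "(\<exists>d. u = \<ominus> \<one> \<oplus> d \<and> d \<in> Delta R) \<longleftrightarrow> u \<oplus> \<one> \<in> Delta R" by metis+
  qed
  \<comment> \<open>This inclusion holds in every ring, so all content of \<open>WDeltaU\<close> is
    in the reverse one.\<close>
  have "{\<one> \<oplus> d | d. d \<in> Delta R} \<union> {\<ominus> \<one> \<oplus> d | d. d \<in> Delta R} \<subseteq> Units R"
    using DeltaD[of _ \<one>] DeltaD[of _ "\<ominus> \<one>"] Units_uminus[OF Units_one_closed]
    by (auto simp: a_comm Delta_carrier)
  then have "WDeltaU R \<longleftrightarrow>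
      Units R \<subseteq> {\<one> \<oplus> d | d. d \<in> Delta R} \<union> {\<ominus> \<one> \<oplus> d | d. d \<in> Delta R}"
    by (auto simp: WDeltaU_def)
  then show ?thesis using 1 2 by (simp add: subset_iff) blast
qed

text \<open>An inverse coset is represented by some \<open>y\<close> with
  \<open>y \<otimes> x\<close> and \<open>x \<otimes> y\<close> congruent to \<open>\<one>\<close>,
  hence units, because adding a radical element to a unit gives a unit. So \<open>x\<close> has a
  left and a right inverse.\<close>

lemma Units_coset_jacobson_radical_iff:
  assumes x: "x \<in> carrier R"
  shows "jacobson_radical R +> x \<in> Units (R Quot jacobson_radical R) \<longleftrightarrow> x \<in> Units R"
proof -
  interpret J: ideal "jacobson_radical R" R by (rule ideal_jacobson_radical)
  let ?J = "jacobson_radical R" and ?Q = "R Quot jacobson_radical R"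
  note h = ring_hom_memE[OF J.rcos_ring_hom]
  have unit: "w \<in> Units R" if "w \<in> carrier R" "?J +> w = ?J +> \<one>" for w
  proof -
    have "w \<ominus> \<one> \<in> ?J" using quotient_eq_iff_same_a_r_cos[OF ideal_jacobson_radical] that by simp
    then have "\<one> \<oplus> (w \<ominus> \<one>) \<in> Units R" by (intro Units_add_jacobson_radical) auto
    then show ?thesis using that(1) by algebra+
  qed
  show ?thesis
  proof
    assume "?J +> x \<in> Units ?Q"
    then obtain Y where Y: "Y \<in> carrier ?Q" "Y \<otimes>\<^bsub>?Q\<^esub> (?J +> x) = \<one>\<^bsub>?Q\<^esub>" "(?J +> x) \<otimes>\<^bsub>?Q\<^esub> Y = \<one>\<^bsub>?Q\<^esub>"
      by (auto simp: Units_def)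
    then obtain y where y: "y \<in> carrier R" "Y = ?J +> y"
      by (auto simp: FactRing_def A_RCOSETS_def')
    have "y \<otimes> x \<in> Units R" "x \<otimes> y \<in> Units R"
      using Y(2,3) y x h(2)[of y x] h(2)[of x y] h(4) by (auto intro!: unit)
    then have "(inv (y \<otimes> x) \<otimes> y) \<otimes> x = \<one>" "x \<otimes> (y \<otimes> inv (x \<otimes> y)) = \<one>"
      "inv (y \<otimes> x) \<otimes> y \<in> carrier R" "y \<otimes> inv (x \<otimes> y) \<in> carrier R"
      using x y(1) by (simp_all add: m_assoc) (simp flip: m_assoc)
    then show "x \<in> Units R" using Units_left_right[OF x] by blast
  next
    assume u: "x \<in> Units R"
    have "(?J +> inv x) \<otimes>\<^bsub>?Q\<^esub> (?J +> x) = \<one>\<^bsub>?Q\<^esub>" "(?J +> x) \<otimes>\<^bsub>?Q\<^esub> (?J +> inv x) = \<one>\<^bsub>?Q\<^esub>"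
      using u x h(4) by (simp_all flip: h(2))
    then show "?J +> x \<in> Units ?Q" using h(1)[of x] h(1)[of "inv x"] x u by (auto simp: Units_def)
  qed
qed

text \<open>Being a unit can be tested on any representative, so the units of the quotient are the
  cosets of units. The condition defining \<open>Delta\<close>, and then that of
  \<open>WDeltaU_iff\<close>, transfers element by element.\<close>

lemma WDeltaU_Quot_jacobson_radical: "WDeltaU (R Quot jacobson_radical R) \<longleftrightarrow> WDeltaU R"
proof -
  interpret J: ideal "jacobson_radical R" R by (rule ideal_jacobson_radical)
  let ?J = "jacobson_radical R" and ?Q = "R Quot jacobson_radical R"
  interpret Q: ring ?Q by (rule J.quotient_is_ring)
  note h = ring_hom_memE[OF J.rcos_ring_hom]
  have carr: "\<exists>x \<in> carrier R. z = ?J +> x" if "z \<in> carrier ?Q" for z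
    using that by (auto simp: FactRing_def A_RCOSETS_def')
  have sub: "Units ?Q = (+>) ?J ` Units R"
  proof
    show "Units ?Q \<subseteq> (+>) ?J ` Units R"
      using carr Q.Units_closed Units_coset_jacobson_radical_iff by blast
  qed (use Units_coset_jacobson_radical_iff Units_closed in blast)
  have D: "?J +> x \<in> Delta ?Q \<longleftrightarrow> x \<in> Delta R" if x: "x \<in> carrier R" for x
  proof -
    have "?J +> x \<in> Delta ?Q \<longleftrightarrow> (\<forall>u \<in> Units R. (?J +> x) \<oplus>\<^bsub>?Q\<^esub> (?J +> u) \<in> Units ?Q)"
      using h(1)[OF x] unfolding Delta_def sub by blast
    also have "\<dots> \<longleftrightarrow> (\<forall>u \<in> Units R. x \<oplus> u \<in> Units R)"
      by (intro ball_cong refl, subst h(3)[symmetric]) (use x Units_coset_jacobson_radical_iff in auto)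
    also have "\<dots> \<longleftrightarrow> x \<in> Delta R" using x by (simp add: Delta_def)
    finally show ?thesis .
  qed
  have "WDeltaU ?Q \<longleftrightarrow>
      (\<forall>u \<in> Units R. (?J +> u) \<ominus>\<^bsub>?Q\<^esub> \<one>\<^bsub>?Q\<^esub> \<in> Delta ?Q \<or> (?J +> u) \<oplus>\<^bsub>?Q\<^esub> \<one>\<^bsub>?Q\<^esub> \<in> Delta ?Q)"
    by (simp add: Q.WDeltaU_iff sub)
  also have "\<dots> \<longleftrightarrow> WDeltaU R"
    unfolding WDeltaU_iff
  proof (rule ball_cong[OF refl])
    fix u assume u: "u \<in> Units R"
    have uc: "u \<in> carrier R" using u by auto
    have "?J +> (\<ominus> \<one>) = \<ominus>\<^bsub>?Q\<^esub> \<one>\<^bsub>?Q\<^esub>"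
    proof -
      interpret h: ring_hom_ring R ?Q "(+>) ?J" by (rule J.rcos_ring_hom_ring)
      show ?thesis by (simp only: h.hom_a_inv[OF one_closed] h(4))
    qed
    then have "(?J +> u) \<ominus>\<^bsub>?Q\<^esub> \<one>\<^bsub>?Q\<^esub> = ?J +> (u \<ominus> \<one>)" "(?J +> u) \<oplus>\<^bsub>?Q\<^esub> \<one>\<^bsub>?Q\<^esub> = ?J +> (u \<oplus> \<one>)"
      using uc h(3)[of u "\<ominus> \<one>"] h(3)[of u \<one>] h(4) by (simp_all add: a_minus_def)
    then show "((?J +> u) \<ominus>\<^bsub>?Q\<^esub> \<one>\<^bsub>?Q\<^esub> \<in> Delta ?Q \<or> (?J +> u) \<oplus>\<^bsub>?Q\<^esub> \<one>\<^bsub>?Q\<^esub> \<in> Delta ?Q) \<longleftrightarrow>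
      (u \<ominus> \<one> \<in> Delta R \<or> u \<oplus> \<one> \<in> Delta R)"
      using u by (simp add: D Units_closed)
  qed
  finally show ?thesis .
qed

section \<open>From \<open>Delta\<close> to the radical: idempotents become central\<close>

text \<open>For a unit \<open>u\<close>, the two alternatives of \<open>WDeltaU_iff\<close> write
  \<open>2 + u\<close> as \<open>((u - 1) + 4) - 1\<close> or as \<open>(u + 1) + 1\<close>, each
  time an element of \<open>Delta R\<close> plus a unit.\<close>

lemma WDeltaU_two_in_Delta:
  assumes "WDeltaU R" and four: "(\<one> \<oplus> \<one>) \<oplus> (\<one> \<oplus> \<one>) \<in> Delta R"
  shows "\<one> \<oplus> \<one> \<in> Delta R"
proof -
  have "\<one> \<oplus> \<one> \<oplus> u \<in> Units R" if u: "u \<in> Units R" for u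
  proof -
    from assms(1) u consider "u \<ominus> \<one> \<in> Delta R" | "u \<oplus> \<one> \<in> Delta R" by (auto simp: WDeltaU_iff)
    then show ?thesis
    proof cases
      case 1
      have "(u \<ominus> \<one> \<oplus> ((\<one> \<oplus> \<one>) \<oplus> (\<one> \<oplus> \<one>))) \<oplus> \<ominus> \<one> \<in> Units R"
        by (rule DeltaD[OF Delta_add[OF 1 four] Units_uminus[OF Units_one_closed]])
      then show ?thesis using Units_closed[OF u] by algebra
    next
      case 2
      then have "(u \<oplus> \<one>) \<oplus> \<one> \<in> Units R" by (rule DeltaD[OF _ Units_one_closed])
      then show ?thesis using Units_closed[OF u] by algebra
    qed
  qed
  then show ?thesis by (auto simp: Delta_def)
qed

text \<open>
  If \<open>1 + a \<in> -1 + \<Delta>(R)\<close>, the commutator of \<open>2 + a\<close> with \<open>v\<close> puts \<open>2a\<close>, and then \<open>4\<close> and \<open>2\<close>, into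
  \<open>\<Delta>(R)\<close>.
\<close>

lemma WDeltaU_square_zero_in_Delta:
  assumes W: "WDeltaU R" and a: "a \<in> carrier R" and sq: "a \<otimes> a = \<zero>"
    and v: "v \<in> Units R" "v \<otimes> a = a" "a \<otimes> v = \<ominus> a"
  shows "a \<in> Delta R"
proof -
  have vc: "v \<in> carrier R" using v(1) by auto
  have "(\<one> \<oplus> a) \<otimes> (\<one> \<ominus> a) = \<one>" "(\<one> \<ominus> a) \<otimes> (\<one> \<oplus> a) = \<one>" using a sq by algebra+
  then have "\<one> \<oplus> a \<in> Units R" using a by (intro Units_left_right[of _ "\<one> \<ominus> a" "\<one> \<ominus> a"]) auto
  with W consider "\<one> \<oplus> a \<ominus> \<one> \<in> Delta R" | "\<one> \<oplus> a \<oplus> \<one> \<in> Delta R" by (auto simp: WDeltaU_iff)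
  then show ?thesis
  proof cases
    case 1
    then show ?thesis using a by algebra+
  next
    case 2
    let ?d = "\<one> \<oplus> a \<oplus> \<one>"
    have "v \<otimes> ?d \<ominus> ?d \<otimes> v \<in> Delta R"
      using 2 v(1) by (intro Delta_minus Delta_mult_Units_left Delta_mult_Units_right)
    moreover have "v \<otimes> ?d \<ominus> ?d \<otimes> v = a \<oplus> a"
      using a vc v(2,3) by algebra+
    ultimately have "(?d \<oplus> ?d) \<ominus> (a \<oplus> a) \<in> Delta R" using Delta_minus[OF Delta_add[OF 2 2]] by simp
    moreover have "(?d \<oplus> ?d) \<ominus> (a \<oplus> a) = (\<one> \<oplus> \<one>) \<oplus> (\<one> \<oplus> \<one>)" using a by algebra+
    ultimately have "\<one> \<oplus> \<one> \<in> Delta R" using WDeltaU_two_in_Delta[OF W] by simp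
    with 2 have "?d \<ominus> (\<one> \<oplus> \<one>) \<in> Delta R" by (rule Delta_minus)
    then show ?thesis using a by algebra+
  qed
qed

lemma idempotent_compl:
  assumes "e \<in> carrier R" "e \<otimes> e = e"
  shows "(\<one> \<ominus> e) \<otimes> (\<one> \<ominus> e) = \<one> \<ominus> e" "e \<otimes> (\<one> \<ominus> e) = \<zero>" "(\<one> \<ominus> e) \<otimes> e = \<zero>" "\<one> \<ominus> (\<one> \<ominus> e) = e"
  using assms by algebra+

text \<open>The reflection \<open>e \<ominus> (\<one> \<ominus> e)\<close> squares to
  \<open>\<one>\<close>, fixes elements of this corner from the left and negates them from the
  right. Those elements square to zero, so \<open>WDeltaU_square_zero_in_Delta\<close>
  applies.\<close>

lemma WDeltaU_idempotent_corner_in_Delta: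
  assumes W: "WDeltaU R" and e: "e \<in> carrier R" "e \<otimes> e = e" and x: "x \<in> carrier R"
  shows "e \<otimes> x \<otimes> (\<one> \<ominus> e) \<in> Delta R"
proof (rule WDeltaU_square_zero_in_Delta[OF W, where v = "e \<ominus> (\<one> \<ominus> e)"])
  note c = idempotent_compl[OF e]
  define f where "f = \<one> \<ominus> e"
  have f: "f \<in> carrier R" "f \<otimes> f = f" "e \<otimes> f = \<zero>" "f \<otimes> e = \<zero>"
    unfolding f_def using e(1) c by auto
  have ef: "e \<oplus> f = \<one>" unfolding f_def using e(1) by algebra
  have r: "e \<otimes> (e \<otimes> y) = e \<otimes> y" "f \<otimes> (f \<otimes> y) = f \<otimes> y"
     "e \<otimes> (f \<otimes> y) = \<zero>" "f \<otimes> (e \<otimes> y) = \<zero>" if "y \<in> carrier R" for y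
    using e f that by (simp_all flip: m_assoc)
  show "e \<otimes> x \<otimes> (\<one> \<ominus> e) \<in> carrier R" using e x by simp
  show "e \<otimes> x \<otimes> (\<one> \<ominus> e) \<otimes> (e \<otimes> x \<otimes> (\<one> \<ominus> e)) = \<zero>"
    "(e \<ominus> (\<one> \<ominus> e)) \<otimes> (e \<otimes> x \<otimes> (\<one> \<ominus> e)) = e \<otimes> x \<otimes> (\<one> \<ominus> e)"
    "e \<otimes> x \<otimes> (\<one> \<ominus> e) \<otimes> (e \<ominus> (\<one> \<ominus> e)) = \<ominus> (e \<otimes> x \<otimes> (\<one> \<ominus> e))"
    unfolding f_def[symmetric] using e f x r by algebra+
  have "(e \<ominus> f) \<otimes> (e \<ominus> f) = e \<oplus> f"
    using e f by algebra
  then have "(e \<ominus> f) \<otimes> (e \<ominus> f) = \<one>" by (simp only: ef)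
  then show "e \<ominus> (\<one> \<ominus> e) \<in> Units R"
    unfolding f_def[symmetric] using e(1) f(1) by (intro Units_left_right) auto
qed

text \<open>
  Let \<open>a = ex(1 - e)\<close>. As \<open>ay = e(ay)\<close>, left invertibility of \<open>1 - ya\<close> reduces, by swapping factors twice,
  to that of \<open>1 - aye\<close>, where \<open>aye = a \<cdot> (1 - e)ye \<in> \<Delta>(R)\<close>.
\<close>

lemma WDeltaU_idempotent_corner_in_jacobson_radical:
  assumes W: "WDeltaU R" and e: "e \<in> carrier R" "e \<otimes> e = e" and x: "x \<in> carrier R"
  shows "e \<otimes> x \<otimes> (\<one> \<ominus> e) \<in> jacobson_radical R"
proof (rule jacobson_radicalI)
  define f where "f = \<one> \<ominus> e"
  have f: "f \<in> carrier R" "f \<otimes> f = f" "\<one> \<ominus> f = e"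
    unfolding f_def using e(1) idempotent_compl[OF e] by auto
  let ?a = "e \<otimes> x \<otimes> (\<one> \<ominus> e)"
  show a: "?a \<in> carrier R" using e x by simp
  fix y assume y: "y \<in> carrier R"
  have "?a \<otimes> (f \<otimes> y \<otimes> e) \<in> Delta R"
    using WDeltaU_idempotent_corner_in_Delta[OF W e x]
      WDeltaU_idempotent_corner_in_Delta[OF W f(1,2) y] unfolding f(3) by (rule Delta_mult)
  then have "\<ominus> (?a \<otimes> (f \<otimes> y \<otimes> e)) \<oplus> \<one> \<in> Units R" by (intro DeltaD Delta_uminus) auto
  moreover have "\<ominus> (?a \<otimes> (f \<otimes> y \<otimes> e)) \<oplus> \<one> = \<one> \<ominus> (e \<otimes> x \<otimes> (f \<otimes> f) \<otimes> y) \<otimes> e"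
    unfolding f_def[symmetric] using e(1) x y f(1) by algebra+
  ultimately have u: "\<one> \<ominus> (?a \<otimes> y) \<otimes> e \<in> Units R" using f(2) by (simp add: f_def)
  obtain s where "s \<in> carrier R" "s \<otimes> (\<one> \<ominus> e \<otimes> (?a \<otimes> y)) = \<one>"
    using left_inv_one_minus_swap[of "?a \<otimes> y" e "inv (\<one> \<ominus> (?a \<otimes> y) \<otimes> e)"] u a y e(1) by auto
  moreover have "e \<otimes> (?a \<otimes> y) = ?a \<otimes> y"
    using e x y f(1) unfolding f_def[symmetric] by (simp flip: m_assoc)
  ultimately show "\<exists>s\<in>carrier R. s \<otimes> (\<one> \<ominus> y \<otimes> ?a) = \<one>"
    using left_inv_one_minus_swap[OF a y] by simp
qed

text \<open>With zero radical, the corners belonging to \<open>e\<close> and to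
  \<open>\<one> \<ominus> e\<close> both vanish, so \<open>e \<otimes> x\<close> and
  \<open>x \<otimes> e\<close> both equal \<open>e \<otimes> x \<otimes> e\<close>.\<close>

lemma WDeltaU_idempotent_central:
  assumes "WDeltaU R" "jacobson_radical R = {\<zero>}" "e \<in> carrier R" "e \<otimes> e = e" "x \<in> carrier R"
  shows "e \<otimes> x = x \<otimes> e"
proof -
  have 1: "e \<otimes> x \<otimes> (\<one> \<ominus> e) = \<zero>" "(\<one> \<ominus> e) \<otimes> x \<otimes> e = \<zero>"
    using WDeltaU_idempotent_corner_in_jacobson_radical[of e x]
      WDeltaU_idempotent_corner_in_jacobson_radical[of "\<one> \<ominus> e" x] idempotent_compl[of e] assms by auto
  have "e \<otimes> x = e \<otimes> x \<otimes> (\<one> \<ominus> e) \<oplus> e \<otimes> x \<otimes> e" using assms by algebra+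
  also have "\<dots> = (\<one> \<ominus> e) \<otimes> x \<otimes> e \<oplus> e \<otimes> x \<otimes> e" by (simp add: 1)
  also have "\<dots> = x \<otimes> e" using assms by algebra+
  finally show ?thesis .
qed

end

section \<open>Artinian rings with central idempotents\<close>

context ring begin

text \<open>The chains \<open>R x^n\<close> and \<open>x^n R\<close> become constant, so beyond a
  common exponent \<open>x^n\<close> lies in \<open>R x^(2n)\<close> and in \<open>x^(2n) R\<close>.
  The successor keeps the exponent positive, which lets \<open>artinian_fitting_idempotent\<close>
  split off a factor \<open>x\<close>.\<close>

lemma artinian_strongly_pi_regular:
  assumes "left_artinian R" "right_artinian R" and x: "x \<in> carrier R"
  obtains m p q where "p \<in> carrier R" "q \<in> carrier R"
    "p \<otimes> (x [^] Suc m \<otimes> x [^] Suc m) = x [^] Suc m"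
    "(x [^] Suc m \<otimes> x [^] Suc m) \<otimes> q = x [^] Suc m"
proof -
  let ?L = "\<lambda>n :: nat. {r \<otimes> x [^] n | r. r \<in> carrier R}"
  let ?R = "\<lambda>n :: nat. {x [^] n \<otimes> r | r. r \<in> carrier R}"
  have "left_ideal (?L n) R" for n using x by (intro left_ideal_principal) simp
  moreover have "?L (Suc n) \<subseteq> ?L n" for n
  proof
    fix y assume "y \<in> ?L (Suc n)"
    then obtain r where r: "r \<in> carrier R" "y = r \<otimes> x [^] Suc n" by blast
    then have "y = (r \<otimes> x) \<otimes> x [^] n" using x nat_pow_Suc2[OF x, of n] by (simp add: m_assoc)
    then show "y \<in> ?L n" using r(1) x by blast
  qed
  ultimately obtain M where M: "\<And>n. n \<ge> M \<Longrightarrow> ?L n = ?L M"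
    using assms(1)[unfolded left_artinian_def, rule_format, of ?L] by blast
  have "right_ideal (?R n) R" for n using x by (intro right_ideal_principal) simp
  moreover have "?R (Suc n) \<subseteq> ?R n" for n
  proof
    fix y assume "y \<in> ?R (Suc n)"
    then obtain r where r: "r \<in> carrier R" "y = x [^] Suc n \<otimes> r" by blast
    then have "y = x [^] n \<otimes> (x \<otimes> r)" using x by (simp add: m_assoc)
    then show "y \<in> ?R n" using r(1) x by blast
  qed
  ultimately obtain N where N: "\<And>n. n \<ge> N \<Longrightarrow> ?R n = ?R N"
    using assms(2)[unfolded right_artinian_def, rule_format, of ?R] by blast
  let ?m = "M + N"
  have "x [^] Suc ?m = \<one> \<otimes> x [^] Suc ?m" "x [^] Suc ?m = x [^] Suc ?m \<otimes> \<one>"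
    using x by (simp_all del: nat_pow_Suc)
  then have "x [^] Suc ?m \<in> ?L (Suc ?m)" "x [^] Suc ?m \<in> ?R (Suc ?m)"
    using one_closed by blast+
  moreover have "?L (Suc ?m) = ?L (Suc ?m + Suc ?m)" "?R (Suc ?m) = ?R (Suc ?m + Suc ?m)"
    using M[of "Suc ?m"] M[of "Suc ?m + Suc ?m"] N[of "Suc ?m"] N[of "Suc ?m + Suc ?m"] by auto
  ultimately have "x [^] Suc ?m \<in> ?L (Suc ?m + Suc ?m)" "x [^] Suc ?m \<in> ?R (Suc ?m + Suc ?m)"
    by (simp_all only:)
  then obtain p q where "p \<in> carrier R" "q \<in> carrier R"
    "x [^] Suc ?m = p \<otimes> x [^] (Suc ?m + Suc ?m)" "x [^] Suc ?m = x [^] (Suc ?m + Suc ?m) \<otimes> q"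
    by blast
  then show thesis using that[of p q ?m] x nat_pow_mult[OF x, of "Suc ?m" "Suc ?m"] by simp
qed

text \<open>With \<open>a = x [^] Suc m\<close>, the relations \<open>p a a = a = a a q\<close> give
  \<open>p a = p a a q = a q\<close>; this element is \<open>e\<close>. The two descriptions make it
  idempotent and, as \<open>x\<close> divides \<open>a\<close> on both sides, a multiple of
  \<open>x\<close> from either side. The last conclusion says that \<open>\<one> \<ominus> e\<close>
  kills a power of \<open>x\<close>.\<close>

lemma artinian_fitting_idempotent:
  assumes "left_artinian R" "right_artinian R" and x: "x \<in> carrier R"
  obtains e g h and n :: nat where "e \<in> carrier R" "g \<in> carrier R" "h \<in> carrier R"
    "e \<otimes> e = e" "g \<otimes> x = e" "x \<otimes> h = e" "x [^] n \<otimes> e = x [^] n"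
proof -
  obtain m p q where pq: "p \<in> carrier R" "q \<in> carrier R"
    "p \<otimes> (x [^] Suc m \<otimes> x [^] Suc m) = x [^] Suc m"
    "(x [^] Suc m \<otimes> x [^] Suc m) \<otimes> q = x [^] Suc m"
    using artinian_strongly_pi_regular[OF assms] by metis
  define a where "a = x [^] Suc m"
  have a: "a \<in> carrier R" "p \<otimes> (a \<otimes> a) = a" "a \<otimes> (a \<otimes> q) = a"
    using x pq by (simp_all add: a_def m_assoc)
  have pa: "p \<otimes> a = a \<otimes> q"
  proof -
    have "p \<otimes> a = p \<otimes> (a \<otimes> (a \<otimes> q))" by (simp only: a(3))
    also have "\<dots> = (p \<otimes> (a \<otimes> a)) \<otimes> q" using a(1) pq(1,2) by algebra
    finally show ?thesis by (simp only: a(2))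
  qed
  have ee: "(p \<otimes> a) \<otimes> (p \<otimes> a) = p \<otimes> a"
  proof -
    have "(p \<otimes> a) \<otimes> (p \<otimes> a) = p \<otimes> (a \<otimes> (a \<otimes> q))" unfolding pa using a(1) pq(1,2)
      by (simp add: m_assoc flip: pa)
    then show ?thesis by (simp only: a(3))
  qed
  have "x [^] m \<otimes> x = a" "x \<otimes> x [^] m = a"
    unfolding a_def using nat_pow_Suc2[OF x, of m] by simp_all
  then have w: "(p \<otimes> x [^] m) \<otimes> x = p \<otimes> a" "x \<otimes> (x [^] m \<otimes> q) = a \<otimes> q"
    using x pq(1,2) by (simp_all add: m_assoc) (simp flip: m_assoc)
  have "x [^] Suc m \<otimes> (p \<otimes> a) = x [^] Suc m"
    unfolding a_def[symmetric] by (simp only: pa a(3))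
  then show thesis
    using that[OF _ _ _ ee w(1) w(2)[folded pa]] a(1) pq(1,2) x by blast
qed

text \<open>Partial sums of the geometric series: their product with
  \<open>\<one> \<ominus> t\<close> telescopes to \<open>\<one> \<ominus> t [^] k\<close>.\<close>

lemma one_minus_nilpotent_left_inv:
  assumes t: "t \<in> carrier R" and nil: "t [^] (n :: nat) = \<zero>"
  shows "\<exists>s \<in> carrier R. s \<otimes> (\<one> \<ominus> t) = \<one>"
proof -
  have "\<exists>s \<in> carrier R. s \<otimes> (\<one> \<ominus> t) = \<one> \<ominus> t [^] k" for k :: nat
  proof (induction k)
    case 0
    show ?case using t by (intro bexI[of _ \<zero>]) (auto simp: minus_eq r_neg)
  next
    case (Suc k)
    then obtain s where s: "s \<in> carrier R" "s \<otimes> (\<one> \<ominus> t) = \<one> \<ominus> t [^] k" by blast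
    define y where "y = t [^] k"
    have y: "y \<in> carrier R" using t by (simp add: y_def)
    have "(s \<oplus> y) \<otimes> (\<one> \<ominus> t) = s \<otimes> (\<one> \<ominus> t) \<oplus> y \<otimes> (\<one> \<ominus> t)"
      using s(1) t y by (intro l_distr) auto
    also have "\<dots> = (\<one> \<ominus> y) \<oplus> y \<otimes> (\<one> \<ominus> t)" by (simp only: s(2) y_def)
    also have "\<dots> = \<one> \<ominus> y \<otimes> t" using t y by algebra
    finally show ?case using s(1) y by (auto simp: y_def)
  qed
  from this[of n] show ?thesis using nil by (simp add: minus_eq)
qed

text \<open>The radical test asks for a left inverse of
  \<open>\<one> \<ominus> y \<otimes> z\<close>, although \<open>y \<otimes> z\<close> is not
  visibly nilpotent. Its Fitting idempotent \<open>e\<close> is central, so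
  \<open>e = g y z e = g y e z\<close> can be fed into itself and makes \<open>e\<close> a left
  multiple of every \<open>z [^] i\<close>. Hence \<open>e = \<zero>\<close>, and
  \<open>y \<otimes> z\<close> is nilpotent after all.\<close>

lemma nilpotent_eq_zero:
  assumes art: "left_artinian R" "right_artinian R" and J: "jacobson_radical R = {\<zero>}"
    and central: "\<And>e x. e \<in> carrier R \<Longrightarrow> e \<otimes> e = e \<Longrightarrow> x \<in> carrier R \<Longrightarrow> e \<otimes> x = x \<otimes> e"
    and z: "z \<in> carrier R" "z [^] (n :: nat) = \<zero>"
  shows "z = \<zero>"
proof -
  have "z \<in> jacobson_radical R"
  proof (rule jacobson_radicalI[OF z(1)])
    fix y assume y: "y \<in> carrier R"
    obtain e g h and k :: nat where e: "e \<in> carrier R" "g \<in> carrier R" "h \<in> carrier R"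
      "e \<otimes> e = e" "g \<otimes> (y \<otimes> z) = e" "(y \<otimes> z) \<otimes> h = e" "(y \<otimes> z) [^] k \<otimes> e = (y \<otimes> z) [^] k"
      by (rule artinian_fitting_idempotent[OF art m_closed[OF y z(1)]], rule that)
    have "\<exists>w \<in> carrier R. e = w \<otimes> z [^] i" for i :: nat
    proof (induction i)
      case 0
      show ?case using e(1) by (intro bexI[of _ e]) auto
    next
      case (Suc i)
      then obtain w where w: "w \<in> carrier R" "e = w \<otimes> z [^] i" by blast
      have "e = (g \<otimes> y \<otimes> z) \<otimes> e" using e y z(1) by (simp add: m_assoc)
      also have "\<dots> = (g \<otimes> y) \<otimes> (e \<otimes> z)" using e(1,2) y z(1) central[OF e(1,4) z(1)] by (simp add: m_assoc)
      also have "\<dots> = (g \<otimes> y) \<otimes> ((w \<otimes> z [^] i) \<otimes> z)" by (simp only: w(2)[symmetric])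
      also have "\<dots> = (g \<otimes> y \<otimes> w) \<otimes> z [^] Suc i" using e(2) y z(1) w(1) by (simp add: m_assoc)
      finally show ?case using e(2) y w(1) by blast
    qed
    from this[of n] have "e = \<zero>" using z(2) by auto
    then have "(y \<otimes> z) [^] k = \<zero>" using e(7) y z(1) by simp
    then show "\<exists>s\<in>carrier R. s \<otimes> (\<one> \<ominus> y \<otimes> z) = \<one>"
      using one_minus_nilpotent_left_inv[of "y \<otimes> z"] y z(1) by blast
  qed
  then show ?thesis using J by simp
qed

text \<open>The unit is \<open>x \<otimes> e \<oplus> f\<close>: it acts as \<open>x\<close> where
  \<open>x\<close> is invertible and as the identity on the complement; \<open>g\<close> and
  \<open>h\<close> supply its one-sided inverses. Since \<open>x \<otimes> f\<close> is nilpotent,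
  it is zero, and so \<open>x = x \<otimes> e\<close>.\<close>

lemma unit_idempotent_decomposition:
  assumes art: "left_artinian R" "right_artinian R" and J: "jacobson_radical R = {\<zero>}"
    and central: "\<And>e x. e \<in> carrier R \<Longrightarrow> e \<otimes> e = e \<Longrightarrow> x \<in> carrier R \<Longrightarrow> e \<otimes> x = x \<otimes> e"
    and x: "x \<in> carrier R"
  obtains u e where "u \<in> Units R" "e \<in> carrier R" "e \<otimes> e = e" "x = u \<otimes> e"
proof -
  obtain e g h and n :: nat where e: "e \<in> carrier R" "g \<in> carrier R" "h \<in> carrier R"
    "e \<otimes> e = e" "g \<otimes> x = e" "x \<otimes> h = e" "x [^] n \<otimes> e = x [^] n"
    by (rule artinian_fitting_idempotent[OF art x], rule that)
  define f where "f = \<one> \<ominus> e"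
  have f: "f \<in> carrier R" "f \<otimes> f = f" "e \<otimes> f = \<zero>" "f \<otimes> e = \<zero>"
    unfolding f_def using e(1) idempotent_compl[OF e(1,4)] by auto
  have ef: "e \<oplus> f = \<one>" unfolding f_def using e(1) by algebra
  note ce = central[OF e(1,4)] and cf = central[OF f(1,2)]
  \<comment> \<open>For \<open>k = 0\<close> this would read \<open>\<one> = f\<close>.\<close>
  have pow: "(x \<otimes> f) [^] k = x [^] k \<otimes> f" if "k > 0" for k :: nat
    using that
  proof (induction k)
    case (Suc k)
    show ?case
    proof (cases "k = 0")
      case False
      then have "(x \<otimes> f) [^] Suc k = x [^] k \<otimes> (f \<otimes> x) \<otimes> f" using Suc x f(1) by (simp add: m_assoc)
      also have "\<dots> = x [^] k \<otimes> x \<otimes> (f \<otimes> f)" using cf[OF x] x f(1) by (simp add: m_assoc)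
      finally show ?thesis using f(2) by simp
    qed (use x f(1) in simp)
  qed simp
  have "x [^] Suc n \<otimes> f = \<zero>"
  proof -
    have "x [^] Suc n \<otimes> f = x \<otimes> (x [^] n \<otimes> e) \<otimes> f"
      using x f(1) by (simp only: e(7) nat_pow_Suc2[OF x])
    also have "\<dots> = x \<otimes> x [^] n \<otimes> (e \<otimes> f)" using x e(1) f(1) by (simp add: m_assoc)
    finally show ?thesis using f(3) x by simp
  qed
  then have "(x \<otimes> f) [^] Suc n = \<zero>" using pow[of "Suc n"] by simp
  then have xf: "x \<otimes> f = \<zero>" using nilpotent_eq_zero[OF art J central] x f(1) by blast
  have "(g \<otimes> e \<oplus> f) \<otimes> (x \<otimes> e \<oplus> f) = g \<otimes> (e \<otimes> x) \<otimes> e \<oplus> g \<otimes> (e \<otimes> f) \<oplus> (f \<otimes> x) \<otimes> e \<oplus> f \<otimes> f"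
    using e(1,2) f(1) x by algebra
  also have "\<dots> = (g \<otimes> x) \<otimes> (e \<otimes> e) \<oplus> g \<otimes> (e \<otimes> f) \<oplus> x \<otimes> (f \<otimes> e) \<oplus> f \<otimes> f"
    unfolding ce[OF x] cf[OF x] using e(1,2) f(1) x by algebra
  also have "\<dots> = \<one>" using e f x ef by simp
  finally have 1: "(g \<otimes> e \<oplus> f) \<otimes> (x \<otimes> e \<oplus> f) = \<one>" .
  have "(x \<otimes> e \<oplus> f) \<otimes> (h \<otimes> e \<oplus> f) = x \<otimes> (e \<otimes> h) \<otimes> e \<oplus> x \<otimes> (e \<otimes> f) \<oplus> (f \<otimes> h) \<otimes> e \<oplus> f \<otimes> f"
    using e(1,3) f(1) x by algebra
  also have "\<dots> = (x \<otimes> h) \<otimes> (e \<otimes> e) \<oplus> x \<otimes> (e \<otimes> f) \<oplus> h \<otimes> (f \<otimes> e) \<oplus> f \<otimes> f"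
    unfolding ce[OF e(3)] cf[OF e(3)] using e(1,3) f(1) x by algebra
  also have "\<dots> = \<one>" using e f x ef by simp
  finally have 2: "(x \<otimes> e \<oplus> f) \<otimes> (h \<otimes> e \<oplus> f) = \<one>" .
  have "x \<otimes> e \<oplus> f \<in> Units R"
    using Units_left_right[OF _ _ _ 1 2] e f(1) x by simp
  moreover have "(x \<otimes> e \<oplus> f) \<otimes> e = x"
  proof -
    have "(x \<otimes> e \<oplus> f) \<otimes> e = x \<otimes> (e \<otimes> e) \<oplus> f \<otimes> e" using x e(1) f(1) by algebra
    also have "\<dots> = x \<otimes> e \<oplus> x \<otimes> f" using x e(1,4) f(4) xf by simp
    also have "\<dots> = x \<otimes> (e \<oplus> f)" using x e(1) f(1) by algebra
    finally show ?thesis using x ef by simp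
  qed
  ultimately show thesis using that e(1,4) by metis
qed

section \<open>Vanishing of \<open>Delta\<close> and rings with units \<plusminus>1\<close>

text \<open>The unit \<open>e \<oplus> \<ominus> \<one>\<close> annihilates
  \<open>e\<close>.\<close>

lemma Delta_idempotent_eq_zero:
  assumes e: "e \<in> Delta R" "e \<otimes> e = e"
  shows "e = \<zero>"
proof -
  have c: "e \<in> carrier R" using e by (auto dest: Delta_carrier)
  define u where "u = e \<oplus> \<ominus> \<one>"
  have u: "u \<in> Units R" unfolding u_def using DeltaD[OF e(1) Units_uminus[OF Units_one_closed]] .
  then have uc: "u \<in> carrier R" by auto
  have "u \<otimes> e = \<zero>" unfolding u_def using c e(2) by algebra
  moreover have "inv u \<otimes> (u \<otimes> e) = e" using u c uc by (simp flip: m_assoc)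
  ultimately show ?thesis using u by simp
qed

text \<open>Multiplying \<open>d = u \<otimes> e\<close> by \<open>inv u\<close> stays in
  \<open>Delta R\<close> and leaves the idempotent \<open>e\<close>, which must vanish. The
  hypothesis is the bare decomposition property so that division rings and semi-simple rings are
  both covered.\<close>

lemma Delta_eq_zero:
  assumes "\<And>x. x \<in> carrier R \<Longrightarrow> \<exists>u \<in> Units R. \<exists>e \<in> carrier R. e \<otimes> e = e \<and> x = u \<otimes> e"
  shows "Delta R \<subseteq> {\<zero>}"
proof
  fix d assume d: "d \<in> Delta R"
  obtain u e where ue: "u \<in> Units R" "e \<in> carrier R" "e \<otimes> e = e" "d = u \<otimes> e"
    using assms[OF Delta_carrier[OF d]] by blast
  have "inv u \<otimes> d = e" using ue by (simp add: Units_closed flip: m_assoc)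
  then have "e \<in> Delta R" using Delta_mult_Units_left[OF d, of "inv u"] ue(1) by simp
  then have "e = \<zero>" using ue(3) Delta_idempotent_eq_zero by blast
  then show "d \<in> {\<zero>}" using ue(1,4) by (simp add: Units_closed)
qed

lemma WDeltaU_Units_subset:
  assumes "WDeltaU R" "Delta R \<subseteq> {\<zero>}"
  shows "Units R \<subseteq> {\<one>, \<ominus> \<one>}"
proof
  fix u assume u: "u \<in> Units R"
  then have uc: "u \<in> carrier R" by auto
  from u assms have "u \<ominus> \<one> = \<zero> \<or> u \<oplus> \<one> = \<zero>" by (auto simp: WDeltaU_iff)
  moreover have "u = (u \<ominus> \<one>) \<oplus> \<one>" "u = (u \<oplus> \<one>) \<oplus> \<ominus> \<one>" using uc by algebra+
  ultimately have "u = \<zero> \<oplus> \<one> \<or> u = \<zero> \<oplus> \<ominus> \<one>" by metis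
  then show "u \<in> {\<one>, \<ominus> \<one>}" by auto
qed

lemma WDeltaU_if_Units_subset:
  assumes "Units R \<subseteq> {\<one>, \<ominus> \<one>}"
  shows "WDeltaU R"
proof -
  have "\<zero> \<in> Delta R" by (auto simp: Delta_def Units_closed)
  moreover have "\<one> \<ominus> \<one> = \<zero>" "\<ominus> \<one> \<oplus> \<one> = \<zero>" using one_closed by algebra+
  ultimately have "\<one> \<ominus> \<one> \<in> Delta R" "\<ominus> \<one> \<oplus> \<one> \<in> Delta R" by (simp_all only:)
  then show ?thesis using assms unfolding WDeltaU_iff by blast
qed

end

text \<open>Commutativity follows from the second conclusion: up to sign, every element is a central
  idempotent. It is what makes the corners of commutative rings available later.\<close>

lemma WDeltaU_semisimple_Units:
  fixes R (structure)
  assumes "semisimple_artinian R" "WDeltaU R"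
  shows "Units R \<subseteq> {\<one>, \<ominus> \<one>}"
    and "x \<in> carrier R \<Longrightarrow> \<exists>e \<in> carrier R. e \<otimes> e = e \<and> (x = e \<or> x = \<ominus> e)"
    and "cring R"
proof -
  interpret ring R using assms by (simp add: semisimple_artinian_def)
  have J: "jacobson_radical R = {\<zero>}" and art: "left_artinian R" "right_artinian R"
    using assms by (auto simp: semisimple_artinian_def)
  note central = WDeltaU_idempotent_central[OF assms(2) J]
  have dec: "\<exists>u \<in> Units R. \<exists>e \<in> carrier R. e \<otimes> e = e \<and> x = u \<otimes> e" if "x \<in> carrier R" for x
    by (rule unit_idempotent_decomposition[OF art J _ that]) (use central in blast)+
  show U: "Units R \<subseteq> {\<one>, \<ominus> \<one>}"
    by (rule WDeltaU_Units_subset[OF assms(2) Delta_eq_zero[OF dec]])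
  have si: "\<exists>e \<in> carrier R. e \<otimes> e = e \<and> (x = e \<or> x = \<ominus> e)" if x: "x \<in> carrier R" for x
  proof -
    obtain u e where ue: "u \<in> Units R" "e \<in> carrier R" "e \<otimes> e = e" "x = u \<otimes> e"
      using dec[OF x] by blast
    have "u = \<one> \<or> u = \<ominus> \<one>" using U ue(1) by blast
    then have "x = e \<or> x = \<ominus> e" using ue(2,4) by (auto simp: l_minus)
    then show ?thesis using ue(2,3) by blast
  qed
  then show "x \<in> carrier R \<Longrightarrow> \<exists>e \<in> carrier R. e \<otimes> e = e \<and> (x = e \<or> x = \<ominus> e)" .
  have "x \<otimes> y = y \<otimes> x" if x: "x \<in> carrier R" and y: "y \<in> carrier R" for x y
  proof -
    obtain e where e: "e \<in> carrier R" "e \<otimes> e = e" "x = e \<or> x = \<ominus> e" using si[OF x] by blast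
    then show ?thesis using central[OF e(1,2) y] y by (auto simp: l_minus r_minus)
  qed
  then show "cring R" by unfold_locales
qed

section \<open>Sums of \<open>\<int>\<^sub>2\<close> and \<open>\<int>\<^sub>3\<close>\<close>

lemma ring_residue_ring: "m > 1 \<Longrightarrow> ring (residue_ring m)"
  using residues.cring[of m] cring.axioms(1) by (auto simp: residues_def)

lemma residue_ring_simps:
  "carrier (residue_ring m) = {0..m - 1}" "x \<otimes>\<^bsub>residue_ring m\<^esub> y = (x * y) mod m"
  "x \<oplus>\<^bsub>residue_ring m\<^esub> y = (x + y) mod m" "\<one>\<^bsub>residue_ring m\<^esub> = 1" "\<zero>\<^bsub>residue_ring m\<^esub> = 0"
  by (simp_all add: residue_ring_def)

lemma residue_ring_2_not_iso_3: "\<not> residue_ring 2 \<simeq> residue_ring 3"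
  using ring_iso_same_card[of "residue_ring 2" "residue_ring 3"] by (auto simp: residue_ring_simps)

lemma (in ring) iso_residue_ring_2:
  assumes "\<one> \<noteq> \<zero>" "\<one> \<oplus> \<one> = \<zero>" and all: "\<And>x. x \<in> carrier R \<Longrightarrow> x = \<zero> \<or> x = \<one>"
  shows "R \<simeq> residue_ring 2"
proof -
  have carr: "carrier R = {\<zero>, \<one>}" using all by auto
  have "(\<lambda>x. if x = \<zero> then 0 else 1) \<in> ring_iso R (residue_ring 2)"
  proof (rule ring_iso_memI)
    have "{0..1} = {0, 1 :: int}" by auto
    then show "bij_betw (\<lambda>x. if x = \<zero> then 0 else 1) (carrier R) (carrier (residue_ring 2))"
      using assms(1) by (auto simp: bij_betw_def inj_on_def carr residue_ring_simps)
  qed (use assms(1,2) in \<open>auto simp: carr residue_ring_simps\<close>)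
  then show ?thesis by (auto simp: is_ring_iso_def)
qed

text \<open>The element \<open>\<one> \<oplus> \<one>\<close> is neither \<open>\<zero>\<close> nor
  \<open>\<one>\<close>, so the trichotomy forces
  \<open>\<one> \<oplus> \<one> \<oplus> \<one> = \<zero>\<close>, and both tables follow. Negation
  is phrased as \<open>x \<oplus> \<one> = \<zero>\<close> because \<open>corner_simps\<close>
  translates the sum and zero of a corner, but not its \<open>a_inv\<close>.\<close>

lemma (in ring) iso_residue_ring_3:
  assumes "\<one> \<oplus> \<one> \<noteq> \<zero>"
    and all: "\<And>x. x \<in> carrier R \<Longrightarrow> x = \<zero> \<or> x = \<one> \<or> x \<oplus> \<one> = \<zero>"
  shows "R \<simeq> residue_ring 3"
proof -
  define t where "t = \<one> \<oplus> \<one>"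
  have ne: "\<one> \<noteq> \<zero>" using assms(1) by auto
  have tc: "t \<in> carrier R" by (simp add: t_def)
  have "t \<noteq> \<one>"
  proof
    assume "t = \<one>"
    then have "(\<one> \<oplus> \<one>) \<ominus> \<one> = \<one> \<ominus> \<one>" by (simp add: t_def)
    moreover have "(\<one> \<oplus> \<one>) \<ominus> \<one> = \<one>" "\<one> \<ominus> \<one> = \<zero>" using one_closed by algebra+
    ultimately show False using ne by simp
  qed
  then have t: "t \<noteq> \<zero>" "t \<noteq> \<one>" "t \<oplus> \<one> = \<zero>"
    using all[OF tc] assms(1) by (auto simp: t_def)
  have t1: "\<one> \<oplus> t = \<zero>" using t(3) tc by (simp add: a_comm)
  have tt: "t \<oplus> t = \<one>"
  proof -
    have "t \<oplus> t = \<one> \<oplus> (\<one> \<oplus> t)" unfolding t_def using one_closed by algebra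
    then show ?thesis using t1 by simp
  qed
  have tm: "t \<otimes> t = \<one>"
  proof -
    have "t \<otimes> t = t \<oplus> t" unfolding t_def using one_closed by algebra
    then show ?thesis using tt by simp
  qed
  have "x = t" if "x \<in> carrier R" "x \<oplus> \<one> = \<zero>" for x
  proof -
    have "x = (x \<oplus> \<one>) \<oplus> t" using that(1) tc t1 by (simp add: a_assoc)
    then show ?thesis using that(2) tc by simp
  qed
  then have carr: "carrier R = {\<zero>, \<one>, t}" using all tc by auto
  have "(\<lambda>x. if x = \<zero> then 0 else if x = \<one> then 1 else 2) \<in> ring_iso R (residue_ring 3)"
  proof (rule ring_iso_memI)
    have "{0..2} = {0, 1, 2 :: int}" by auto
    then show "bij_betw (\<lambda>x. if x = \<zero> then 0 else if x = \<one> then 1 else 2) (carrier R) (carrier (residue_ring 3))"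
      using ne t by (auto simp: bij_betw_def inj_on_def carr residue_ring_simps)
  qed (use ne t t1 tt tm tc in \<open>auto simp: carr residue_ring_simps t_def[symmetric]\<close>)
  then show ?thesis by (auto simp: is_ring_iso_def)
qed

section \<open>Units under isomorphisms and in finite direct products\<close>

lemma Units_ring_iso:
  assumes h: "h \<in> ring_iso R S"
  shows "h ` Units R \<subseteq> Units S"
proof clarify
  fix u assume "u \<in> Units R"
  then obtain v where uv: "u \<in> carrier R" "v \<in> carrier R"
    "v \<otimes>\<^bsub>R\<^esub> u = \<one>\<^bsub>R\<^esub>" "u \<otimes>\<^bsub>R\<^esub> v = \<one>\<^bsub>R\<^esub>" by (auto simp: Units_def)
  then have "h v \<otimes>\<^bsub>S\<^esub> h u = \<one>\<^bsub>S\<^esub>" "h u \<otimes>\<^bsub>S\<^esub> h v = \<one>\<^bsub>S\<^esub>"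
    using ring_iso_memE(2)[OF h] ring_iso_memE(4)[OF h] by metis+
  then show "h u \<in> Units S" using uv ring_iso_memE(1)[OF h] by (auto simp: Units_def)
qed

lemma Units_subset_ring_iso:
  assumes "ring R" "ring S" "R \<simeq> S"
  shows "Units S \<subseteq> {\<one>\<^bsub>S\<^esub>} \<Longrightarrow> Units R \<subseteq> {\<one>\<^bsub>R\<^esub>}"
    and "Units S \<subseteq> {\<one>\<^bsub>S\<^esub>, \<ominus>\<^bsub>S\<^esub> \<one>\<^bsub>S\<^esub>} \<Longrightarrow> Units R \<subseteq> {\<one>\<^bsub>R\<^esub>, \<ominus>\<^bsub>R\<^esub> \<one>\<^bsub>R\<^esub>}"
proof -
  obtain h where h: "h \<in> ring_iso R S" using assms(3) by (auto simp: is_ring_iso_def)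
  interpret R: ring R by fact
  interpret S: ring S by fact
  interpret h: ring_hom_ring R S h
    using h assms by (auto simp: ring_iso_def intro: ring_hom_ringI2)
  have inj: "x = y" if "x \<in> carrier R" "y \<in> carrier R" "h x = h y" for x y
    using ring_iso_memE(5)[OF h] that by (auto simp: bij_betw_def inj_on_def)
  have "h u \<in> Units S" if "u \<in> Units R" for u using Units_ring_iso[OF h] that by blast
  moreover have "h (\<ominus>\<^bsub>R\<^esub> \<one>\<^bsub>R\<^esub>) = \<ominus>\<^bsub>S\<^esub> \<one>\<^bsub>S\<^esub>" by simp
  ultimately show
    "Units S \<subseteq> {\<one>\<^bsub>S\<^esub>} \<Longrightarrow> Units R \<subseteq> {\<one>\<^bsub>R\<^esub>}"
    "Units S \<subseteq> {\<one>\<^bsub>S\<^esub>, \<ominus>\<^bsub>S\<^esub> \<one>\<^bsub>S\<^esub>} \<Longrightarrow> Units R \<subseteq> {\<one>\<^bsub>R\<^esub>, \<ominus>\<^bsub>R\<^esub> \<one>\<^bsub>R\<^esub>}"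
    using inj h.hom_one R.Units_closed R.one_closed R.a_inv_closed by (smt (verit) insert_iff singleton_iff subset_iff)+
qed

lemma zero_notin_Units_residue_ring: "0 \<notin> Units (residue_ring m)"
  by (auto simp: Units_def residue_ring_simps)

lemma Units_residue_ring_2: "Units (residue_ring 2) \<subseteq> {\<one>\<^bsub>residue_ring 2\<^esub>}"
proof
  fix u assume u: "u \<in> Units (residue_ring 2)"
  then have "u \<noteq> 0" "0 \<le> u" "u \<le> 1"
    using zero_notin_Units_residue_ring[of 2] by (auto simp: Units_def residue_ring_simps)
  then show "u \<in> {\<one>\<^bsub>residue_ring 2\<^esub>}" by (simp add: residue_ring_simps)
qed

lemma Units_residue_ring_3:
  "Units (residue_ring 3) \<subseteq> {\<one>\<^bsub>residue_ring 3\<^esub>, \<ominus>\<^bsub>residue_ring 3\<^esub> \<one>\<^bsub>residue_ring 3\<^esub>}"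
proof
  interpret ring "residue_ring 3" by (rule ring_residue_ring) simp
  have neg: "\<ominus>\<^bsub>residue_ring 3\<^esub> \<one>\<^bsub>residue_ring 3\<^esub> = 2"
    by (rule minus_equality) (simp_all add: residue_ring_simps)
  fix u assume u: "u \<in> Units (residue_ring 3)"
  then have "u \<noteq> 0" "0 \<le> u" "u \<le> 2"
    using zero_notin_Units_residue_ring[of 3] by (auto simp: Units_def residue_ring_simps)
  then show "u \<in> {\<one>\<^bsub>residue_ring 3\<^esub>, \<ominus>\<^bsub>residue_ring 3\<^esub> \<one>\<^bsub>residue_ring 3\<^esub>}"
    unfolding neg by (simp add: residue_ring_simps) linarith
qed

lemma RDirProd_simps:
  "carrier (RDirProd R S) = carrier R \<times> carrier S"
  "\<one>\<^bsub>RDirProd R S\<^esub> = (\<one>\<^bsub>R\<^esub>, \<one>\<^bsub>S\<^esub>)" "\<zero>\<^bsub>RDirProd R S\<^esub> = (\<zero>\<^bsub>R\<^esub>, \<zero>\<^bsub>S\<^esub>)"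
  "(a, b) \<otimes>\<^bsub>RDirProd R S\<^esub> (c, d) = (a \<otimes>\<^bsub>R\<^esub> c, b \<otimes>\<^bsub>S\<^esub> d)"
  "(a, b) \<oplus>\<^bsub>RDirProd R S\<^esub> (c, d) = (a \<oplus>\<^bsub>R\<^esub> c, b \<oplus>\<^bsub>S\<^esub> d)"
  by (auto simp: RDirProd_def DirProd_def monoid.defs)

lemma Units_RDirProd: "Units (RDirProd R S) = Units R \<times> Units S"
  by (fastforce simp: Units_def RDirProd_simps)

lemma a_inv_one_RDirProd:
  assumes "ring R" "ring S"
  shows "\<ominus>\<^bsub>RDirProd R S\<^esub> \<one>\<^bsub>RDirProd R S\<^esub> = (\<ominus>\<^bsub>R\<^esub> \<one>\<^bsub>R\<^esub>, \<ominus>\<^bsub>S\<^esub> \<one>\<^bsub>S\<^esub>)"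
proof -
  interpret R: ring R by fact
  interpret S: ring S by fact
  interpret P: ring "RDirProd R S" using assms by (rule RDirProd_ring)
  show ?thesis by (rule P.minus_equality) (auto simp: RDirProd_simps R.l_neg S.l_neg)
qed

text \<open>The two claims need a joint induction. If the head has three elements, the tail may
  contribute only the unit \<open>\<one>\<close>, since otherwise the signs could be chosen
  independently; this is the first claim for the tail. If the head has two elements, the second
  claim is passed on.\<close>

lemma Units_RDirProd_list:
  fixes Rs :: "('a, 'm) ring_scheme list"
  assumes "\<forall>i < length Rs. ring (Rs ! i)"
    and "\<forall>i < length Rs. Rs ! i \<simeq> residue_ring 2 \<or> Rs ! i \<simeq> residue_ring 3"
  shows "((\<forall>i < length Rs. \<not> Rs ! i \<simeq> residue_ring 3) \<longrightarrow>
           Units (RDirProd_list Rs) \<subseteq> {\<one>\<^bsub>RDirProd_list Rs\<^esub>}) \<and>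
         ((\<forall>i < length Rs. \<forall>j < length Rs.
            Rs ! i \<simeq> residue_ring 3 \<and> Rs ! j \<simeq> residue_ring 3 \<longrightarrow> i = j) \<longrightarrow>
           Units (RDirProd_list Rs) \<subseteq> {\<one>\<^bsub>RDirProd_list Rs\<^esub>, \<ominus>\<^bsub>RDirProd_list Rs\<^esub> \<one>\<^bsub>RDirProd_list Rs\<^esub>})"
  using assms
proof (induction Rs)
  case Nil
  show ?case by (auto simp: Units_def monoid.defs)
next
  case (Cons R Rs)
  let ?L = "RDirProd_list Rs"
  let ?P = "RDirProd R ?L" and ?C = "RDirProd_list (R # Rs)"
  have rings: "\<forall>i < length Rs. ring (Rs ! i)" "ring R"
    and isos: "\<forall>i < length Rs. Rs ! i \<simeq> residue_ring 2 \<or> Rs ! i \<simeq> residue_ring 3"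
      "R \<simeq> residue_ring 2 \<or> R \<simeq> residue_ring 3"
    using Cons.prems by force+
  note IH = Cons.IH[OF rings(1) isos(1)]
  interpret R: ring R by fact
  interpret L: ring ?L using rings(1) by (intro RDirProd_list_is_ring) auto
  have C: "ring ?C" using Cons.prems(1) by (intro RDirProd_list_is_ring) auto
  have P: "ring ?P" using RDirProd_ring R.ring_axioms L.ring_axioms by blast
  have "?P \<simeq> ?C" using RDirProd_list_iso1 by (auto simp: is_ring_iso_def)
  then have CP: "?C \<simeq> ?P" by (rule ring_iso_sym[OF P])
  note toC = Units_subset_ring_iso[OF C P CP]
  \<comment> \<open>A factor whose only unit is \<open>1\<close> has \<open>-1 = 1\<close>, so the
    sign of the other factor is the sign of the whole pair.\<close>
  have neg1: "\<ominus>\<^bsub>?L\<^esub> \<one>\<^bsub>?L\<^esub> = \<one>\<^bsub>?L\<^esub>" if "Units ?L \<subseteq> {\<one>\<^bsub>?L\<^esub>}"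
    using that L.Units_uminus[OF L.Units_one_closed] by blast
  have neg2: "\<ominus>\<^bsub>R\<^esub> \<one>\<^bsub>R\<^esub> = \<one>\<^bsub>R\<^esub>" if "Units R \<subseteq> {\<one>\<^bsub>R\<^esub>}"
    using that R.Units_uminus[OF R.Units_one_closed] by blast
  have R2: "Units R \<subseteq> {\<one>\<^bsub>R\<^esub>}" if "R \<simeq> residue_ring 2"
    using Units_subset_ring_iso(1)[OF R.ring_axioms ring_residue_ring that Units_residue_ring_2] by simp
  have R3: "Units R \<subseteq> {\<one>\<^bsub>R\<^esub>, \<ominus>\<^bsub>R\<^esub> \<one>\<^bsub>R\<^esub>}" if "R \<simeq> residue_ring 3"
    using Units_subset_ring_iso(2)[OF R.ring_axioms ring_residue_ring that Units_residue_ring_3] by simp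
  note a1 = a_inv_one_RDirProd[OF R.ring_axioms L.ring_axioms]
  show ?case
  proof (intro conjI impI)
    assume "\<forall>i < length (R # Rs). \<not> (R # Rs) ! i \<simeq> residue_ring 3"
    then have "\<not> R \<simeq> residue_ring 3" "\<forall>i < length Rs. \<not> Rs ! i \<simeq> residue_ring 3" by force+
    then have "Units R \<subseteq> {\<one>\<^bsub>R\<^esub>}" "Units ?L \<subseteq> {\<one>\<^bsub>?L\<^esub>}" using IH R2 isos(2) by auto
    then show "Units ?C \<subseteq> {\<one>\<^bsub>?C\<^esub>}"
      by (intro toC(1)) (auto simp: Units_RDirProd RDirProd_simps)
  next
    assume one: "\<forall>i < length (R # Rs). \<forall>j < length (R # Rs).
      (R # Rs) ! i \<simeq> residue_ring 3 \<and> (R # Rs) ! j \<simeq> residue_ring 3 \<longrightarrow> i = j"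
    show "Units ?C \<subseteq> {\<one>\<^bsub>?C\<^esub>, \<ominus>\<^bsub>?C\<^esub> \<one>\<^bsub>?C\<^esub>}"
    proof (cases "R \<simeq> residue_ring 3")
      case True
      then have "\<forall>i < length Rs. \<not> Rs ! i \<simeq> residue_ring 3"
        using one[rule_format, of 0 "Suc i" for i] by auto
      then have L1: "Units ?L \<subseteq> {\<one>\<^bsub>?L\<^esub>}" using IH by blast
      show ?thesis
        using R3[OF True] L1 neg1[OF L1]
        by (intro toC(2), unfold a1) (auto simp: Units_RDirProd RDirProd_simps(2))
    next
      case False
      then have R1: "Units R \<subseteq> {\<one>\<^bsub>R\<^esub>}" using R2 isos(2) by blast
      have "\<forall>i < length Rs. \<forall>j < length Rs.
          Rs ! i \<simeq> residue_ring 3 \<and> Rs ! j \<simeq> residue_ring 3 \<longrightarrow> i = j"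
        using one[rule_format, of "Suc i" "Suc j" for i j] by auto
      then have "Units ?L \<subseteq> {\<one>\<^bsub>?L\<^esub>, \<ominus>\<^bsub>?L\<^esub> \<one>\<^bsub>?L\<^esub>}" using IH by blast
      then show ?thesis
        using R1 neg2[OF R1]
        by (intro toC(2), unfold a1) (auto simp: Units_RDirProd RDirProd_simps(2))
    qed
  qed
qed

lemma sum_of_Z2_at_most_one_Z3_Units:
  fixes R (structure)
  assumes "ring R" "sum_of_Z2_at_most_one_Z3 R"
  shows "Units R \<subseteq> {\<one>, \<ominus> \<one>}"
proof -
  obtain Rs :: "int ring list" where Rs: "\<forall>i < length Rs. ring (Rs ! i)" "R \<simeq> RDirProd_list Rs"
    "\<forall>i < length Rs. Rs ! i \<simeq> residue_ring 2 \<or> Rs ! i \<simeq> residue_ring 3"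
    "\<forall>i < length Rs. \<forall>j < length Rs. Rs ! i \<simeq> residue_ring 3 \<and> Rs ! j \<simeq> residue_ring 3 \<longrightarrow> i = j"
    using assms(2) unfolding sum_of_Z2_at_most_one_Z3_def by blast
  have "ring (RDirProd_list Rs)" using Rs(1) by (intro RDirProd_list_is_ring) auto
  then show ?thesis
    using Units_subset_ring_iso(2)[OF assms(1) _ Rs(2)] Units_RDirProd_list[OF Rs(1,3)] Rs(4) by blast
qed

section \<open>Splitting off minimal idempotents\<close>

text \<open>For an idempotent \<open>e\<close> of a commutative ring this is the ring
  \<open>eR\<close>. Describing it by fixed points makes \<open>corner R \<one>\<close> equal to
  \<open>R\<close>, not merely isomorphic.\<close>

definition corner :: "('a, 'm) ring_scheme \<Rightarrow> 'a \<Rightarrow> ('a, 'm) ring_scheme" where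
  "corner R e = R\<lparr>carrier := {x \<in> carrier R. e \<otimes>\<^bsub>R\<^esub> x = x}, one := e\<rparr>"

lemma corner_simps:
  "carrier (corner R e) = {x \<in> carrier R. e \<otimes>\<^bsub>R\<^esub> x = x}" "\<one>\<^bsub>corner R e\<^esub> = e"
  "\<zero>\<^bsub>corner R e\<^esub> = \<zero>\<^bsub>R\<^esub>" "x \<otimes>\<^bsub>corner R e\<^esub> y = x \<otimes>\<^bsub>R\<^esub> y" "x \<oplus>\<^bsub>corner R e\<^esub> y = x \<oplus>\<^bsub>R\<^esub> y"
  by (simp_all add: corner_def)

context cring begin

lemma corner_one: "corner R \<one> = R"
  by (simp add: corner_def cong: conj_cong)

lemma ring_corner:
  assumes e: "e \<in> carrier R" "e \<otimes> e = e"
  shows "ring (corner R e)"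
proof (rule ringI)
  show "abelian_group (corner R e)"
  proof (rule abelian_groupI)
    fix x assume "x \<in> carrier (corner R e)"
    then show "\<exists>y \<in> carrier (corner R e). y \<oplus>\<^bsub>corner R e\<^esub> x = \<zero>\<^bsub>corner R e\<^esub>"
      using e by (intro bexI[of _ "\<ominus> x"]) (auto simp: corner_simps r_minus l_neg)
  qed (use e in \<open>auto simp: corner_simps r_distr a_ac\<close>)
  show "monoid (corner R e)"
  proof (rule monoidI)
    fix x y assume "x \<in> carrier (corner R e)" "y \<in> carrier (corner R e)"
    then show "x \<otimes>\<^bsub>corner R e\<^esub> y \<in> carrier (corner R e)"
      using e(1) m_assoc[of e x y] by (simp add: corner_simps)
  next
    fix x assume "x \<in> carrier (corner R e)"
    then show "x \<otimes>\<^bsub>corner R e\<^esub> \<one>\<^bsub>corner R e\<^esub> = x"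
      using e(1) m_comm[of x e] by (simp add: corner_simps)
  qed (use e in \<open>simp_all add: corner_simps m_assoc\<close>)
qed (auto simp: corner_simps l_distr r_distr)

text \<open>The idempotents \<open>f\<close> and \<open>e \<ominus> f\<close> are orthogonal with
  sum \<open>e\<close>. An element is sent to its products with them, and addition is the inverse
  map.\<close>

lemma corner_decomposition:
  assumes e: "e \<in> carrier R" "e \<otimes> e = e" and f: "f \<in> carrier R" "f \<otimes> f = f" and ef: "e \<otimes> f = f"
  shows "corner R e \<simeq> RDirProd (corner R f) (corner R (e \<ominus> f))"
proof -
  define g where "g = e \<ominus> f"
  have g: "g \<in> carrier R" using e f by (simp add: g_def)
  have gs: "f \<oplus> g = e" unfolding g_def using e(1) f(1) by algebra
  have fe: "f \<otimes> e = f" using m_comm[OF f(1) e(1)] ef by simp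
  have fg: "f \<otimes> g = \<zero>" "g \<otimes> f = \<zero>" "g \<otimes> g = g" "e \<otimes> g = g"
    unfolding g_def using e f ef fe by (simp_all add: minus_eq r_distr l_distr l_minus r_minus r_neg l_neg)
  have r: "f \<otimes> (f \<otimes> y) = f \<otimes> y" "g \<otimes> (g \<otimes> y) = g \<otimes> y" "f \<otimes> (g \<otimes> y) = \<zero>" "g \<otimes> (f \<otimes> y) = \<zero>"
    "e \<otimes> (f \<otimes> y) = f \<otimes> y" "e \<otimes> (g \<otimes> y) = g \<otimes> y" if "y \<in> carrier R" for y
    using that e(1) f g fg ef by (simp_all flip: m_assoc)
  let ?h = "\<lambda>x. (f \<otimes> x, g \<otimes> x)"
  have "?h \<in> ring_iso (corner R e) (RDirProd (corner R f) (corner R g))"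
  proof (rule ring_iso_memI)
    fix x y assume xy: "x \<in> carrier (corner R e)" "y \<in> carrier (corner R e)"
    then have c: "x \<in> carrier R" "y \<in> carrier R" by (auto simp: corner_simps)
    have "a \<otimes> (x \<otimes> y) = (a \<otimes> x) \<otimes> (a \<otimes> y)" if "a \<in> carrier R" "a \<otimes> a = a" for a
    proof -
      have "(a \<otimes> x) \<otimes> (a \<otimes> y) = (a \<otimes> a) \<otimes> (x \<otimes> y)" using that(1) c by (simp add: m_ac)
      then show ?thesis using that(2) by simp
    qed
    then show "?h (x \<otimes>\<^bsub>corner R e\<^esub> y) = ?h x \<otimes>\<^bsub>RDirProd (corner R f) (corner R g)\<^esub> ?h y"
      using f g fg by (simp add: RDirProd_simps corner_simps)
    show "?h (x \<oplus>\<^bsub>corner R e\<^esub> y) = ?h x \<oplus>\<^bsub>RDirProd (corner R f) (corner R g)\<^esub> ?h y"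
      using f(1) g c by (simp add: RDirProd_simps corner_simps r_distr)
  next
    show "?h \<one>\<^bsub>corner R e\<^esub> = \<one>\<^bsub>RDirProd (corner R f) (corner R g)\<^esub>"
      using fe fg(4) m_comm[OF g e(1)] by (simp add: RDirProd_simps corner_simps)
  next
    show "bij_betw ?h (carrier (corner R e)) (carrier (RDirProd (corner R f) (corner R g)))"
    proof (rule bij_betw_byWitness[where f' = "\<lambda>(y, z). y \<oplus> z"])
      have "f \<otimes> x \<oplus> g \<otimes> x = x" if "x \<in> carrier R" "e \<otimes> x = x" for x
        using that f(1) g gs l_distr[OF f(1) g that(1)] by simp
      then show "\<forall>x \<in> carrier (corner R e). (\<lambda>(y, z). y \<oplus> z) (?h x) = x"
        by (auto simp: corner_simps)
      have "f \<otimes> (y \<oplus> z) = y" "g \<otimes> (y \<oplus> z) = z" "e \<otimes> (y \<oplus> z) = y \<oplus> z"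
        if "y \<in> carrier R" "f \<otimes> y = y" "z \<in> carrier R" "g \<otimes> z = z" for y z
      proof -
        have "f \<otimes> z = \<zero>" "g \<otimes> y = \<zero>" "e \<otimes> y = y" "e \<otimes> z = z" using r[OF that(1)] r[OF that(3)] that by simp_all
        then show "f \<otimes> (y \<oplus> z) = y" "g \<otimes> (y \<oplus> z) = z" "e \<otimes> (y \<oplus> z) = y \<oplus> z"
          using that e(1) f(1) g by (simp_all add: r_distr)
      qed
      then show "\<forall>a' \<in> carrier (RDirProd (corner R f) (corner R g)). ?h ((\<lambda>(y, z). y \<oplus> z) a') = a'"
        "(\<lambda>(y, z). y \<oplus> z) ` carrier (RDirProd (corner R f) (corner R g)) \<subseteq> carrier (corner R e)"
        by (auto simp: RDirProd_simps corner_simps)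
      show "?h ` carrier (corner R e) \<subseteq> carrier (RDirProd (corner R f) (corner R g))"
        using r f(1) g by (auto simp: RDirProd_simps corner_simps)
    qed
  qed (use r f(1) g in \<open>auto simp: RDirProd_simps corner_simps\<close>)
  then show ?thesis unfolding g_def is_ring_iso_def by blast
qed

text \<open>In a commutative ring the carrier of a corner is a left ideal, so infinite strict
  descent contradicts the chain condition. The order serves both to find minimal idempotents and to
  run the induction in \<open>corner_iso_sum\<close>.\<close>

lemma wf_corner:
  assumes "left_artinian R"
  shows "wf {(f, e). f \<in> carrier R \<and> e \<in> carrier R \<and> carrier (corner R f) \<subset> carrier (corner R e)}"
proof (rule ccontr)
  let ?r = "{(f, e). f \<in> carrier R \<and> e \<in> carrier R \<and> carrier (corner R f) \<subset> carrier (corner R e)}"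
  assume "\<not> ?thesis"
  then obtain e :: "nat \<Rightarrow> 'a" where "\<forall>n. (e (Suc n), e n) \<in> ?r"
    unfolding wf_iff_no_infinite_down_chain not_not by (elim exE)
  then have e: "\<And>n. e n \<in> carrier R"
    "\<And>n. carrier (corner R (e (Suc n))) \<subset> carrier (corner R (e n))" by auto
  have "left_ideal (carrier (corner R (e n))) R" for n
    by (rule left_idealI) (use e(1)[of n] in \<open>auto simp: corner_simps r_distr m_lcomm\<close>)
  then obtain N where "\<forall>n \<ge> N. carrier (corner R (e n)) = carrier (corner R (e N))"
    using assms[unfolded left_artinian_def, rule_format, of "\<lambda>n. carrier (corner R (e n))"] e(2) by blast
  then have "carrier (corner R (e (Suc N))) = carrier (corner R (e N))"
    using le_SucI[OF order_refl] by blast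
  then show False using e(2)[of N] by blast
qed

text \<open>Take \<open>f\<close> with minimal corner among the nonzero idempotents below
  \<open>e\<close>. Up to sign, an element of that corner is an idempotent \<open>g\<close> below
  \<open>f\<close>; if \<open>g\<close> differs from \<open>f\<close>, its corner is strictly
  smaller, which leaves only \<open>g = \<zero>\<close>.\<close>

lemma minimal_idempotent:
  assumes art: "left_artinian R"
    and signed: "\<And>x. x \<in> carrier R \<Longrightarrow> \<exists>g \<in> carrier R. g \<otimes> g = g \<and> (x = g \<or> x = \<ominus> g)"
    and e: "e \<in> carrier R" "e \<otimes> e = e" "e \<noteq> \<zero>"
  obtains f where "f \<in> carrier R" "f \<otimes> f = f" "f \<noteq> \<zero>" "e \<otimes> f = f"
    "\<And>x. x \<in> carrier (corner R f) \<Longrightarrow> x = \<zero> \<or> x = f \<or> x \<oplus> f = \<zero>"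
proof -
  let ?A = "{f \<in> carrier R. f \<otimes> f = f \<and> f \<noteq> \<zero> \<and> e \<otimes> f = f}"
  have "e \<in> ?A" using e by simp
  let ?r = "{(f, e). f \<in> carrier R \<and> e \<in> carrier R \<and> carrier (corner R f) \<subset> carrier (corner R e)}"
  from \<open>e \<in> ?A\<close> have "\<exists>f \<in> ?A. \<forall>g. (g, f) \<in> ?r \<longrightarrow> g \<notin> ?A"
    by (rule wf_corner[OF art, unfolded wf_eq_minimal, THEN spec, THEN spec, THEN mp])
  then obtain f where A: "f \<in> ?A" and "\<forall>g. (g, f) \<in> ?r \<longrightarrow> g \<notin> ?A" by (rule bexE)
  then have min: "g \<notin> ?A" if "carrier (corner R g) \<subset> carrier (corner R f)" "g \<in> carrier R" for g
    using that A by simp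
  from A have f: "f \<in> carrier R" "f \<otimes> f = f" "f \<noteq> \<zero>" "e \<otimes> f = f" by simp_all
  have "x = \<zero> \<or> x = f \<or> x \<oplus> f = \<zero>" if x: "x \<in> carrier (corner R f)" for x
  proof -
    have xf: "x \<in> carrier R" "f \<otimes> x = x" using x by (auto simp: corner_simps)
    obtain g where g: "g \<in> carrier R" "g \<otimes> g = g" "x = g \<or> x = \<ominus> g" using signed[OF xf(1)] by blast
    have "g = x \<or> g = \<ominus> x" using g(1,3) by auto
    then have fg: "f \<otimes> g = g" using xf f(1) by (auto simp: r_minus)
    have "g = \<zero> \<or> g = f"
    proof (rule disjCI)
      assume "g \<noteq> f"
      have "f \<otimes> y = y" if "y \<in> carrier R" "g \<otimes> y = y" for y
        using that f g(1) fg m_assoc[of f g y] by simp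
      then have "carrier (corner R g) \<subseteq> carrier (corner R f)" by (auto simp: corner_simps)
      moreover have "f \<in> carrier (corner R f)" "f \<notin> carrier (corner R g)"
        using f g(1) fg \<open>g \<noteq> f\<close> m_comm[of f g] by (auto simp: corner_simps)
      ultimately have "g \<notin> ?A" using min[of g] g(1) by blast
      moreover have "e \<otimes> g = g" using f g(1) fg e(1) m_assoc[of e f g] by simp
      ultimately show "g = \<zero>" using g(1,2) by blast
    qed
    then show ?thesis using g(1,3) f by (auto simp: l_neg)
  qed
  then show thesis using that f by blast
qed

text \<open>The clause on \<open>e \<oplus> e = \<zero>\<close> strengthens the induction: once a
  three-element factor is split off, the remainder turns out to have
  \<open>g \<oplus> g = \<zero>\<close>, and the clause excludes a second such factor.\<close>

lemma corner_iso_sum: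
  assumes art: "left_artinian R"
    and signed: "\<And>x. x \<in> carrier R \<Longrightarrow> \<exists>g \<in> carrier R. g \<otimes> g = g \<and> (x = g \<or> x = \<ominus> g)"
    and units: "Units R \<subseteq> {\<one>, \<ominus> \<one>}"
    and e: "e \<in> carrier R" "e \<otimes> e = e"
  shows "\<exists>Rs. corner R e \<simeq> RDirProd_list Rs \<and> set Rs \<subseteq> {residue_ring 2, residue_ring 3} \<and>
    (\<forall>i < length Rs. \<forall>j < length Rs. Rs ! i = residue_ring 3 \<and> Rs ! j = residue_ring 3 \<longrightarrow> i = j) \<and>
    (e \<oplus> e = \<zero> \<longrightarrow> residue_ring 3 \<notin> set Rs)"
  using e
proof (induction e rule: wf_induct_rule[OF wf_corner[OF art]])
  case (1 e)
  note e = 1(2,3)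
  show ?case
  proof (cases "e = \<zero>")
    case True
    have "(\<lambda>_. []) \<in> ring_iso (corner R e) nil_ring"
      by (rule ring_iso_memI) (auto simp: True corner_simps monoid.defs bij_betw_def inj_on_def)
    then show ?thesis by (intro exI[of _ "[]"]) (auto simp: is_ring_iso_def)
  next
    case False
    obtain f where f: "f \<in> carrier R" "f \<otimes> f = f" "f \<noteq> \<zero>" "e \<otimes> f = f"
      and min: "\<And>x. x \<in> carrier (corner R f) \<Longrightarrow> x = \<zero> \<or> x = f \<or> x \<oplus> f = \<zero>"
      using minimal_idempotent[OF art signed e False] by metis
    define g where "g = e \<ominus> f"
    have fe: "f \<otimes> e = f" using m_comm[OF f(1) e(1)] f(4) by simp
    have g: "g \<in> carrier R" "g \<otimes> g = g" "e \<otimes> g = g" "g \<otimes> f = \<zero>"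
      unfolding g_def using e f fe by (simp_all add: minus_eq r_distr l_distr l_minus r_minus r_neg l_neg)
    have "e \<otimes> y = y" if "y \<in> carrier R" "g \<otimes> y = y" for y
      using that g(1,3) e(1) m_assoc[of e g y] by simp
    then have "carrier (corner R g) \<subseteq> carrier (corner R e)" by (auto simp: corner_simps)
    moreover have "f \<in> carrier (corner R e)" "f \<notin> carrier (corner R g)"
      using f(1,3,4) g(4) by (simp_all add: corner_simps)
    ultimately have "carrier (corner R g) \<subset> carrier (corner R e)" by blast
    then have "(g, e) \<in> {(f, e). f \<in> carrier R \<and> e \<in> carrier R \<and> carrier (corner R f) \<subset> carrier (corner R e)}"
      using g(1) e(1) by simp
    then obtain Rs where Rs: "corner R g \<simeq> RDirProd_list Rs" "set Rs \<subseteq> {residue_ring 2, residue_ring 3}"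
      "\<forall>i < length Rs. \<forall>j < length Rs. Rs ! i = residue_ring 3 \<and> Rs ! j = residue_ring 3 \<longrightarrow> i = j"
      "g \<oplus> g = \<zero> \<longrightarrow> residue_ring 3 \<notin> set Rs"
      using 1(1)[OF _ g(1,2)] by blast
    interpret F: ring "corner R f" using ring_corner f by blast
    \<comment> \<open>By minimality \<open>fR\<close> consists of \<open>0\<close>, \<open>f\<close>
      and \<open>-f\<close>; the last two coincide exactly when
      \<open>f \<oplus> f = \<zero>\<close>.\<close>
    define k :: int where "k = (if f \<oplus> f = \<zero> then 2 else 3)"
    have "corner R f \<simeq> residue_ring k"
    proof (cases "f \<oplus> f = \<zero>")
      case True
      have "x = \<zero> \<or> x = f" if x: "x \<in> carrier (corner R f)" for x
      proof (cases "x \<oplus> f = \<zero>")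
        case xf: True
        have "x \<in> carrier R" using x by (simp add: corner_simps)
        then have "x = (x \<oplus> f) \<oplus> f" using f(1) True by (simp add: a_assoc)
        then show ?thesis using xf f(1) by simp
      qed (use min[OF x] in blast)
      then show ?thesis using F.iso_residue_ring_2 True f(3) by (simp add: corner_simps k_def)
    next
      case False
      then show ?thesis using F.iso_residue_ring_3 min by (simp add: corner_simps k_def)
    qed
    then obtain h1 h2 where "h1 \<in> ring_iso (corner R f) (residue_ring k)" "h2 \<in> ring_iso (corner R g) (RDirProd_list Rs)"
      using Rs(1) by (auto simp: is_ring_iso_def)
    then have "RDirProd (corner R f) (corner R g) \<simeq> RDirProd (residue_ring k) (RDirProd_list Rs)"
      unfolding is_ring_iso_def using RDirProd_iso6 by blast
    moreover have "RDirProd (residue_ring k) (RDirProd_list Rs) \<simeq> RDirProd_list (residue_ring k # Rs)"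
      unfolding is_ring_iso_def using RDirProd_list_iso1 by blast
    ultimately have iso: "corner R e \<simeq> RDirProd_list (residue_ring k # Rs)"
      using corner_decomposition[OF e f(1,2,4)] unfolding g_def[symmetric] by (blast intro: ring_iso_trans)
    have ne: "residue_ring 2 \<noteq> residue_ring 3"
      using residue_ring_2_not_iso_3 ring_iso_refl by metis
    have k3: "residue_ring 3 \<notin> set Rs" if "k = 3"
    proof -
      \<comment> \<open>This reflection is \<open>-1\<close> on \<open>fR\<close> and
        \<open>1\<close> on the complement, so it is a unit. It differs from \<open>\<one>\<close>
        because \<open>f \<oplus> f\<close> is nonzero, hence it is \<open>\<ominus> \<one>\<close>;
        comparing its action on \<open>g\<close> gives \<open>\<ominus> g = g\<close>.\<close>
      define v where "v = \<one> \<ominus> (f \<oplus> f)"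
      have v: "v \<in> carrier R" using f(1) by (simp add: v_def)
      have "v \<otimes> v = \<one>" unfolding v_def using f(1,2) by algebra
      then have "v \<in> Units R" using v by (auto intro: Units_left_right)
      moreover have "v \<noteq> \<one>"
      proof
        assume "v = \<one>"
        moreover have "f \<oplus> f = \<one> \<ominus> v" unfolding v_def using f(1) by algebra
        ultimately show False using that by (auto simp: k_def minus_eq r_neg split: if_splits)
      qed
      ultimately have "v = \<ominus> \<one>" using units by blast
      moreover have "g \<otimes> v = g" unfolding v_def using g f(1) by (simp add: minus_eq r_distr r_minus)
      ultimately have "\<ominus> g = g" using g(1) by (simp add: r_minus)
      then have "g \<oplus> g = \<zero>" using l_neg[OF g(1)] by simp
      then show ?thesis using Rs(4) by blast
    qed
    \<comment> \<open>Doubling on \<open>eR\<close> is multiplication by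
      \<open>e \<oplus> e\<close>, so its vanishing passes to \<open>f\<close> and
      \<open>g\<close>.\<close>
    have k2: "k = 2" and "g \<oplus> g = \<zero>" if "e \<oplus> e = \<zero>"
    proof -
      have "y \<oplus> y = \<zero>" if y: "y \<in> carrier R" "e \<otimes> y = y" for y
      proof -
        have "y \<oplus> y = (e \<oplus> e) \<otimes> y" using y e(1) by (simp add: l_distr)
        then show ?thesis using y(1) \<open>e \<oplus> e = \<zero>\<close> by simp
      qed
      then show "k = 2" "g \<oplus> g = \<zero>" using f g by (auto simp: k_def)
    qed
    then have "e \<oplus> e = \<zero> \<longrightarrow> residue_ring 3 \<notin> set (residue_ring k # Rs)" using Rs(4) ne by auto
    moreover have "i = j" if "i < length (residue_ring k # Rs)" "j < length (residue_ring k # Rs)"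
      "(residue_ring k # Rs) ! i = residue_ring 3" "(residue_ring k # Rs) ! j = residue_ring 3" for i j
    proof (cases "k = 3")
      case True
      then have "\<And>l. l < length Rs \<Longrightarrow> Rs ! l \<noteq> residue_ring 3" using k3 nth_mem by metis
      then show ?thesis using that by (cases i; cases j) auto
    next
      case False
      then have "k = 2" by (simp add: k_def split: if_splits)
      then show ?thesis using that Rs(3) ne by (cases i; cases j) auto
    qed
    moreover have "set (residue_ring k # Rs) \<subseteq> {residue_ring 2, residue_ring 3}" using Rs(2) by (auto simp: k_def)
    ultimately show ?thesis using iso by blast
  qed
qed

end

text \<open>This is the corner at \<open>\<one>\<close>. As the two residue rings are not
  isomorphic, a summand isomorphic to \<open>residue_ring 3\<close> is equal to it, so uniqueness
  for equality yields uniqueness up to isomorphism.\<close>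

lemma signed_idempotents_sum_of_Z2_at_most_one_Z3:
  fixes R (structure)
  assumes "cring R" "left_artinian R"
    and "\<And>x. x \<in> carrier R \<Longrightarrow> \<exists>g \<in> carrier R. g \<otimes> g = g \<and> (x = g \<or> x = \<ominus> g)"
    and "Units R \<subseteq> {\<one>, \<ominus> \<one>}"
  shows "sum_of_Z2_at_most_one_Z3 R"
proof -
  interpret cring R by fact
  obtain Rs where Rs: "R \<simeq> RDirProd_list Rs" "set Rs \<subseteq> {residue_ring 2, residue_ring 3}"
    "\<forall>i < length Rs. \<forall>j < length Rs. Rs ! i = residue_ring 3 \<and> Rs ! j = residue_ring 3 \<longrightarrow> i = j"
    using corner_iso_sum[OF assms(2-4) one_closed] by (auto simp: corner_one)
  have mem: "Rs ! i = residue_ring 2 \<or> Rs ! i = residue_ring 3" if "i < length Rs" for i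
    using Rs(2) nth_mem[OF that] by blast
  then have "Rs ! i = residue_ring 3" if "i < length Rs" "Rs ! i \<simeq> residue_ring 3" for i
    using residue_ring_2_not_iso_3 that by metis
  moreover have "ring (Rs ! i)" if "i < length Rs" for i
    using mem[OF that] ring_residue_ring[of 2] ring_residue_ring[of 3] by auto
  moreover have "Rs ! i \<simeq> residue_ring 2 \<or> Rs ! i \<simeq> residue_ring 3" if "i < length Rs" for i
    using mem[OF that] ring_iso_refl by metis
  ultimately show ?thesis
    unfolding sum_of_Z2_at_most_one_Z3_def using Rs(1,3) by (intro exI[of _ Rs]) blast
qed

section \<open>Characterisations for division rings and semi-simple rings\<close>

text \<open>Each element is a unit times \<open>\<one>\<close> or \<open>\<one>\<close> times
  \<open>\<zero>\<close>, so \<open>Delta_eq_zero\<close> applies and \<open>WDeltaU\<close> leaves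
  only the elements \<open>0\<close>, \<open>1\<close>, \<open>-1\<close>. Whether
  \<open>\<one> \<oplus> \<one>\<close> vanishes decides between the two fields.\<close>

lemma division_ring_WDeltaU_iff:
  fixes R (structure)
  assumes "is_division_ring R"
  shows "WDeltaU R \<longleftrightarrow> R \<simeq> residue_ring 2 \<or> R \<simeq> residue_ring 3"
proof -
  interpret ring R using assms by (simp add: is_division_ring_def)
  have ne: "\<one> \<noteq> \<zero>" and U: "Units R = carrier R - {\<zero>}"
    using assms by (auto simp: is_division_ring_def)
  show ?thesis
  proof
    assume W: "WDeltaU R"
    have "\<exists>u \<in> Units R. \<exists>e \<in> carrier R. e \<otimes> e = e \<and> x = u \<otimes> e" if x: "x \<in> carrier R" for x
    proof (cases "x = \<zero>")
      case True
      then have "x = \<one> \<otimes> \<zero>" "\<zero> \<otimes> \<zero> = \<zero>" by simp_all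
      then show ?thesis using Units_one_closed zero_closed by blast
    next
      case False
      then have "x \<in> Units R" "x = x \<otimes> \<one>" "\<one> \<otimes> \<one> = \<one>" using x U by simp_all
      then show ?thesis using one_closed by blast
    qed
    then have "Units R \<subseteq> {\<one>, \<ominus> \<one>}" by (rule WDeltaU_Units_subset[OF W Delta_eq_zero])
    then have all: "x = \<zero> \<or> x = \<one> \<or> x = \<ominus> \<one>" if "x \<in> carrier R" for x
      using U that by blast
    show "R \<simeq> residue_ring 2 \<or> R \<simeq> residue_ring 3"
    proof (cases "\<one> \<oplus> \<one> = \<zero>")
      case True
      then have "\<ominus> \<one> = \<one>" by (simp add: minus_equality)
      then show ?thesis using iso_residue_ring_2[OF ne True] all by metis
    next
      case False
      then show ?thesis using iso_residue_ring_3[OF False] all l_neg[OF one_closed] by metis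
    qed
  next
    assume "R \<simeq> residue_ring 2 \<or> R \<simeq> residue_ring 3"
    then have "Units R \<subseteq> {\<one>} \<or> Units R \<subseteq> {\<one>, \<ominus> \<one>}"
      using Units_subset_ring_iso[OF ring_axioms ring_residue_ring] Units_residue_ring_2 Units_residue_ring_3
      by (metis one_less_numeral_iff semiring_norm(76) semiring_norm(77))
    then show "WDeltaU R" by (intro WDeltaU_if_Units_subset) blast
  qed
qed

lemma semisimple_WDeltaU_iff:
  fixes R (structure)
  assumes "semisimple_artinian R"
  shows "WDeltaU R \<longleftrightarrow> sum_of_Z2_at_most_one_Z3 R"
proof
  have "ring R" "left_artinian R" using assms by (auto simp: semisimple_artinian_def)
  note U = WDeltaU_semisimple_Units[OF assms]
  show "sum_of_Z2_at_most_one_Z3 R" if "WDeltaU R"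
    by (rule signed_idempotents_sum_of_Z2_at_most_one_Z3[OF U(3)[OF that] \<open>left_artinian R\<close> U(2)[OF that] U(1)[OF that]])
  show "WDeltaU R" if "sum_of_Z2_at_most_one_Z3 R"
    using ring.WDeltaU_if_Units_subset sum_of_Z2_at_most_one_Z3_Units \<open>ring R\<close> that by blast
qed

theorem proposition3p1:
  fixes R :: "('a, 'm) ring_scheme"
  assumes "ring R"
  shows "(is_division_ring R \<longrightarrow>
            (WDeltaU R \<longleftrightarrow> R \<simeq> residue_ring 2 \<or> R \<simeq> residue_ring 3)) \<and>
         (is_local_ring R \<longrightarrow>
            (WDeltaU R \<longleftrightarrow>
               R Quot jacobson_radical R \<simeq> residue_ring 2 \<or>
               R Quot jacobson_radical R \<simeq> residue_ring 3)) \<and>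
         (semisimple_artinian R \<longrightarrow>
            (WDeltaU R \<longleftrightarrow> sum_of_Z2_at_most_one_Z3 R)) \<and>
         (is_semilocal_ring R \<longrightarrow>
            (WDeltaU R \<longleftrightarrow> sum_of_Z2_at_most_one_Z3 (R Quot jacobson_radical R)))"
  \<comment> \<open>The local and semi-local clauses are the division ring and semi-simple clauses
    for the quotient by the radical.\<close>
  using division_ring_WDeltaU_iff[of R] division_ring_WDeltaU_iff[of "R Quot jacobson_radical R"]
    semisimple_WDeltaU_iff[of R] semisimple_WDeltaU_iff[of "R Quot jacobson_radical R"]
    ring.WDeltaU_Quot_jacobson_radical[OF assms]
  unfolding is_local_ring_def is_semilocal_ring_def by blast

end
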